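(* Let $d,n\ge1$ be integers and suppose $G$ and $G'$ are subgroups of $\mathrm{U}(d)$ that are one another's centralizers in $\mathrm{U}(d)$. Then, for each choice of sign $\pm$, the following two algebras are the commutants of one another in $\mathrm{End}([(\mathbb{C}^d)^{\otimes n}]_{\pm})$: 1. $\mathrm{Alg}\{\Pi_{\pm}\mathbf{Q}(G)\Pi_{\pm}\}$, the complex algebra spanned by $\Pi_{\pm}\mathbf{Q}(G)\Pi_{\pm}$; 2. $\mathrm{Alg}\{\Pi_{\pm}\mathbf{Q}(G')\Pi_{\pm}\}$, the complex algebra spanned by $\Pi_{\pm}\mathbf{Q}(G')\Pi_{\pm}$.
   Context: $[(\mathbb{C}^d)^{\otimes n}]_{+}$ and $[(\mathbb{C}^d)^{\otimes n}]_{-}$ are the totally symmetric and totally antisymmetric subspaces of $(\mathbb{C}^d)^{\otimes n}$, and $\Pi_{\pm}$ is the orthogonal projector onto $[(\mathbb{C}^d)^{\otimes n}]_{\pm}$. For a subgroup $H\subseteq\mathrm{U}(d)$, $\mathbf{Q}(H)=\{V^{\otimes n}:V\in H\}$, and $\Pi_\pm\mathbf{Q}(H)\Pi_\pm=\{\Pi_\pm V^{\otimes n}\Pi_\pm:V\in H\}$ is regarded as a set of operators on $[(\mathbb{C}^d)^{\otimes n}]_\pm$. The centralizer of a subgroup of $\mathrm{U}(d)$ is the set of elements of $\mathrm{U}(d)$ commuting with all its elements. *)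

theory Defs
  imports "HOL-Analysis.Analysis" "HOL-Algebra.Group"
begin

section \<open>The unitary group and centralizers\<close>

definition conj_transpose :: "complex^'n^'m \<Rightarrow> complex^'m^'n"
  where "conj_transpose A = (\<chi> i j. cnj (A $ j $ i))"

definition unitary_group :: "(complex^'d^'d) monoid"
  where "unitary_group =
    \<lparr>carrier = {U. conj_transpose U ** U = mat 1 \<and> U ** conj_transpose U = mat 1},
     monoid.mult = (**), one = mat 1\<rparr>"

definition unitary_centralizer :: "(complex^'d^'d) set \<Rightarrow> (complex^'d^'d) set"
  where "unitary_centralizer H = {U \<in> carrier unitary_group. \<forall>V\<in>H. U ** V = V ** U}"

lemma conj_transpose_mul: "conj_transpose (A ** B) = conj_transpose B ** conj_transpose A"
  by (simp add: conj_transpose_def matrix_matrix_mult_def vec_eq_iff mult.commute)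

lemma conj_transpose_conj_transpose [simp]: "conj_transpose (conj_transpose A) = A"
  by (simp add: conj_transpose_def vec_eq_iff)

lemma conj_transpose_mat_1 [simp]: "conj_transpose (mat 1) = mat 1"
  by (simp add: conj_transpose_def vec_eq_iff mat_def)

lemma group_unitary_group: "group unitary_group"
proof (rule groupI)
  show "\<exists>V\<in>carrier unitary_group. V \<otimes>\<^bsub>unitary_group\<^esub> U = \<one>\<^bsub>unitary_group\<^esub>"
    if "U \<in> carrier unitary_group" for U :: "complex^'d^'d"
    using that by (intro bexI[of _ "conj_transpose U"]) (auto simp: unitary_group_def)
next
  fix U V :: "complex^'d^'d"
  assume "U \<in> carrier unitary_group" "V \<in> carrier unitary_group"
  then have U: "conj_transpose U ** U = mat 1" "U ** conj_transpose U = mat 1"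
    and V: "conj_transpose V ** V = mat 1" "V ** conj_transpose V = mat 1"
    by (auto simp: unitary_group_def)
  have "conj_transpose (U ** V) ** (U ** V) = conj_transpose V ** (conj_transpose U ** U) ** V"
       "(U ** V) ** conj_transpose (U ** V) = U ** (V ** conj_transpose V) ** conj_transpose U"
    by (simp_all only: conj_transpose_mul matrix_mul_assoc)
  then show "U \<otimes>\<^bsub>unitary_group\<^esub> V \<in> carrier unitary_group"
    using U V by (simp add: unitary_group_def)
qed (auto simp: unitary_group_def matrix_mul_assoc)


section \<open>Tensor powers\<close>

text \<open>
  The \<open>n\<close>-th tensor power of \<open>\<complex>\<^sup>d\<close> is modelled in coordinates as \<open>complex^('n \<Rightarrow> 'd)\<close>, where
  \<open>CARD('n) = n\<close> and \<open>CARD('d) = d\<close>: the tensor factors are labelled by \<open>'n\<close>, and the standard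
  basis vector at \<open>f :: 'n \<Rightarrow> 'd\<close> is the product vector whose factor number \<open>i\<close> is the standard
  basis vector at \<open>f i\<close>.
\<close>

definition tensor_vec :: "('n::finite \<Rightarrow> complex^'d::finite) \<Rightarrow> complex^('n \<Rightarrow> 'd)"
  where "tensor_vec v = (\<chi> f. \<Prod>i\<in>UNIV. v i $ f i)"

definition tensor_power :: "complex^'d::finite^'d \<Rightarrow> complex^('n::finite \<Rightarrow> 'd)^('n \<Rightarrow> 'd)"
  where "tensor_power V = (\<chi> f g. \<Prod>i\<in>UNIV. V $ f i $ g i)"

lemma prod_sum_UNIV:
  fixes h :: "'n::finite \<Rightarrow> 'd::finite \<Rightarrow> 'a::comm_semiring_1"
  shows "(\<Prod>i\<in>UNIV. \<Sum>j\<in>UNIV. h i j) = (\<Sum>f\<in>UNIV. \<Prod>i\<in>UNIV. h i (f i))"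
  using prod_sum_PiE[of UNIV "\<lambda>_. UNIV" h] by (simp add: PiE_UNIV_domain)

lemma tensor_power_tensor_vec:
  fixes V :: "complex^'d^'d" and v :: "'n::finite \<Rightarrow> complex^'d"
  shows "tensor_power V *v tensor_vec v = tensor_vec (\<lambda>i. V *v v i)"
  by (simp add: tensor_power_def tensor_vec_def matrix_vector_mult_def vec_eq_iff prod_sum_UNIV
      flip: prod.distrib)

definition permute_factors :: "('n::finite \<Rightarrow> 'n) \<Rightarrow> complex^('n \<Rightarrow> 'd::finite) \<Rightarrow> complex^('n \<Rightarrow> 'd)"
  where "permute_factors p \<psi> = (\<chi> f. \<psi> $ (f \<circ> p))"

text \<open>For a permutation \<open>p\<close>, the factor number \<open>i\<close> is moved to position \<open>p i\<close>:\<close>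

lemma permute_factors_tensor_vec:
  fixes v :: "'n::finite \<Rightarrow> complex^'d"
  assumes "p permutes UNIV"
  shows "permute_factors p (tensor_vec v) = tensor_vec (v \<circ> inv_into UNIV p)"
proof -
  have "(\<Prod>i\<in>UNIV. v i $ f (p i)) = (\<Prod>i\<in>UNIV. v (inv_into UNIV p i) $ f i)" for f
    using prod.permute[OF assms, of "\<lambda>i. v (inv_into UNIV p i) $ f i"]
    by (simp add: o_def permutes_inverses[OF assms])
  then show ?thesis
    by (simp add: permute_factors_def tensor_vec_def vec_eq_iff)
qed

definition symmetric_subspace :: "(complex^('n::finite \<Rightarrow> 'd::finite)) set"
  where "symmetric_subspace = {\<psi>. \<forall>p. p permutes UNIV \<longrightarrow> permute_factors p \<psi> = \<psi>}"

definition antisymmetric_subspace :: "(complex^('n::finite \<Rightarrow> 'd::finite)) set"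
  where "antisymmetric_subspace =
    {\<psi>. \<forall>p. p permutes UNIV \<longrightarrow> permute_factors p \<psi> = of_int (sign p) *s \<psi>}"


section \<open>Orthogonal projectors\<close>

definition is_orth_projector :: "complex^'k^'k \<Rightarrow> (complex^'k) set \<Rightarrow> bool"
  where "is_orth_projector P W \<longleftrightarrow>
    conj_transpose P = P \<and> P ** P = P \<and> range ((*v) P) = W"

definition orth_projector :: "(complex^'k) set \<Rightarrow> complex^'k^'k"
  where "orth_projector W = (THE P. is_orth_projector P W)"

lemma is_orth_projector_fixes:
  fixes P :: "complex^'k^'k"
  assumes "is_orth_projector P W"
  shows "P *v x = x \<longleftrightarrow> x \<in> W"
proof
  have W: "range ((*v) P) = W" and PP: "P *v (P *v y) = P *v y" for y
    using assms by (simp_all add: is_orth_projector_def matrix_vector_mul_assoc)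
  show "x \<in> W" if "P *v x = x"
    using W that by (metis rangeI)
  show "P *v x = x" if "x \<in> W"
    using W PP that by blast
qed

lemma is_orth_projector_unique:
  assumes P: "is_orth_projector P W" and Q: "is_orth_projector Q W"
  shows "P = Q"
proof -
  have "P ** Q = Q" "Q ** P = P"
    unfolding matrix_eq using P Q is_orth_projector_fixes[OF P] is_orth_projector_fixes[OF Q]
    by (auto simp: is_orth_projector_def simp flip: matrix_vector_mul_assoc)
  then show ?thesis
    using P Q by (metis conj_transpose_mul is_orth_projector_def)
qed

lemma orth_projector_eqI: "is_orth_projector P W \<Longrightarrow> orth_projector W = P"
  unfolding orth_projector_def by (blast intro: the_equality is_orth_projector_unique)

text \<open>
  The projectors onto the symmetric and the antisymmetric subspace exist, so that
  \<^const>\<open>orth_projector\<close> is meaningful for them; they are the averages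
  \<open>(\<Sum>p. \<epsilon> p * P p) / n!\<close> of the permutation operators, with \<open>\<epsilon> = 1\<close> or \<open>\<epsilon> = sign\<close>.
\<close>

definition averaging_matrix ::
    "(('n::finite \<Rightarrow> 'n) \<Rightarrow> complex) \<Rightarrow> complex^('n \<Rightarrow> 'd::finite)^('n \<Rightarrow> 'd)"
  where "averaging_matrix \<epsilon> = (\<chi> f g.
    (\<Sum>p | p permutes (UNIV :: 'n set). \<epsilon> p * of_bool (g = f \<circ> p)) / fact CARD('n))"

lemma averaging_matrix_apply:
  fixes \<psi> :: "complex^('n::finite \<Rightarrow> 'd::finite)"
  shows "(averaging_matrix \<epsilon> *v \<psi>) $ f =
    (\<Sum>p | p permutes (UNIV :: 'n set). \<epsilon> p * \<psi> $ (f \<circ> p)) / fact CARD('n)"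
proof -
  have "(averaging_matrix \<epsilon> *v \<psi>) $ f =
      (\<Sum>g\<in>UNIV. \<Sum>p | p permutes (UNIV :: 'n set). \<epsilon> p * of_bool (g = f \<circ> p) * \<psi> $ g) / fact CARD('n)"
    by (simp only: averaging_matrix_def matrix_vector_mult_def vec_lambda_beta times_divide_eq_left
        sum_distrib_right sum_divide_distrib)
  also have "(\<Sum>g\<in>UNIV. \<Sum>p | p permutes (UNIV :: 'n set). \<epsilon> p * of_bool (g = f \<circ> p) * \<psi> $ g) =
      (\<Sum>p | p permutes (UNIV :: 'n set). \<Sum>g\<in>UNIV. \<epsilon> p * of_bool (g = f \<circ> p) * \<psi> $ g)"
    by (rule sum.swap)
  also have "\<dots> = (\<Sum>p | p permutes (UNIV :: 'n set). \<epsilon> p * \<psi> $ (f \<circ> p))"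
    by (intro sum.cong refl) (simp add: mult.assoc of_bool_def mult_delta_left
        flip: sum_distrib_left)
  finally show ?thesis .
qed

lemma is_orth_projector_averaging:
  fixes \<epsilon> :: "('n::finite \<Rightarrow> 'n) \<Rightarrow> complex"
  assumes comp: "\<And>p q. p permutes UNIV \<Longrightarrow> q permutes UNIV \<Longrightarrow> \<epsilon> (p \<circ> q) = \<epsilon> p * \<epsilon> q"
    and real: "\<And>p. \<epsilon> p * \<epsilon> p = 1" "\<And>p. cnj (\<epsilon> p) = \<epsilon> p"
    and inv: "\<And>p. p permutes UNIV \<Longrightarrow> \<epsilon> (inv_into UNIV p) = \<epsilon> p"
  shows "is_orth_projector (averaging_matrix \<epsilon>)
    {\<psi> :: complex^('n \<Rightarrow> 'd::finite). \<forall>p. p permutes UNIV \<longrightarrow> permute_factors p \<psi> = \<epsilon> p *s \<psi>}"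
    (is "is_orth_projector ?P ?W")
proof -
  have fix_W: "?P *v \<psi> = \<psi>" if "\<psi> \<in> ?W" for \<psi>
  proof -
    have "\<psi> $ (f \<circ> p) = \<epsilon> p * \<psi> $ f" if "p permutes UNIV" for f p
      using \<open>\<psi> \<in> ?W\<close> that by (force simp: permute_factors_def vec_eq_iff)
    then have "(\<Sum>p | p permutes UNIV. \<epsilon> p * \<psi> $ (f \<circ> p)) = (\<Sum>p | p permutes (UNIV :: 'n set). \<psi> $ f)"
      for f
      by (intro sum.cong) (auto simp: real simp flip: mult.assoc)
    then show ?thesis
      by (simp add: vec_eq_iff averaging_matrix_apply card_permutations)
  qed
  have into_W: "?P *v \<psi> \<in> ?W" for \<psi>
  proof (intro CollectI allI impI)
    fix q :: "'n \<Rightarrow> 'n" assume q: "q permutes UNIV"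
    have "(\<Sum>p | p permutes UNIV. \<epsilon> p * \<psi> $ (f \<circ> q \<circ> p)) =
        \<epsilon> q * (\<Sum>p | p permutes UNIV. \<epsilon> p * \<psi> $ (f \<circ> p))" for f
    proof -
      have "\<epsilon> q * (\<Sum>p | p permutes UNIV. \<epsilon> p * \<psi> $ (f \<circ> p)) =
          (\<Sum>p | p permutes UNIV. \<epsilon> q * (\<epsilon> (q \<circ> p) * \<psi> $ (f \<circ> (q \<circ> p))))"
        by (subst setum_permutations_compose_left[OF q]) (simp add: sum_distrib_left)
      also have "\<dots> = (\<Sum>p | p permutes UNIV. \<epsilon> p * \<psi> $ (f \<circ> q \<circ> p))"
        by (intro sum.cong) (auto simp: comp[OF q] real o_assoc simp flip: mult.assoc)
      finally show ?thesis by simp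
    qed
    then show "permute_factors q (?P *v \<psi>) = \<epsilon> q *s (?P *v \<psi>)"
      by (simp add: permute_factors_def vec_eq_iff averaging_matrix_apply)
  qed
  have "conj_transpose ?P = ?P"
  proof -
    have "(\<Sum>p | p permutes UNIV. cnj (\<epsilon> p) * of_bool (f = g \<circ> p)) =
        (\<Sum>p | p permutes UNIV. \<epsilon> p * of_bool (g = f \<circ> p))" for f g :: "'n \<Rightarrow> 'd"
    proof -
      have "f = g \<circ> inv_into UNIV p \<longleftrightarrow> g = f \<circ> p" if "p permutes UNIV" for p
        using permutes_inv_o[OF that] by (metis comp_assoc comp_id)
      then show ?thesis
        by (subst sum_permutations_inverse) (auto simp: real inv intro!: sum.cong)
    qed
    then show ?thesis
      by (simp add: conj_transpose_def averaging_matrix_def vec_eq_iff of_bool_def if_distrib cong: if_cong)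
  qed
  moreover have "?P ** ?P = ?P"
    using fix_W into_W by (simp add: matrix_eq flip: matrix_vector_mul_assoc)
  moreover have "range ((*v) ?P) = ?W"
    using fix_W into_W by (metis (no_types, lifting) image_subsetI rangeI subsetI subset_antisym)
  ultimately show ?thesis
    by (simp add: is_orth_projector_def)
qed

lemma is_orth_projector_symmetric:
  "is_orth_projector (orth_projector symmetric_subspace)
     (symmetric_subspace :: (complex^('n::finite \<Rightarrow> 'd::finite)) set)"
proof -
  have "is_orth_projector (averaging_matrix (\<lambda>_. 1))
      (symmetric_subspace :: (complex^('n \<Rightarrow> 'd)) set)"
    using is_orth_projector_averaging[of "\<lambda>_. 1"] by (simp add: symmetric_subspace_def)
  then show ?thesis
    by (simp add: orth_projector_eqI)
qed

lemma is_orth_projector_antisymmetric: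
  "is_orth_projector (orth_projector antisymmetric_subspace)
     (antisymmetric_subspace :: (complex^('n::finite \<Rightarrow> 'd::finite)) set)"
proof -
  have *: "permutation p" if "p permutes UNIV" for p :: "'n \<Rightarrow> 'n"
    using that by (rule permutes_imp_permutation[OF finite])
  have "is_orth_projector (averaging_matrix (\<lambda>p. of_int (sign p)))
      (antisymmetric_subspace :: (complex^('n \<Rightarrow> 'd)) set)"
    unfolding antisymmetric_subspace_def
  proof (rule is_orth_projector_averaging)
    show "of_int (sign (p \<circ> q)) = (of_int (sign p) * of_int (sign q) :: complex)"
      if "p permutes UNIV" "q permutes UNIV" for p q :: "'n \<Rightarrow> 'n"
      by (simp only: sign_compose[OF *[OF that(1)] *[OF that(2)]] of_int_mult)
    show "of_int (sign p) * of_int (sign p) = (1 :: complex)" for p :: "'n \<Rightarrow> 'n"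
      by (simp only: sign_idempotent of_int_1 flip: of_int_mult)
    show "of_int (sign (inv_into UNIV p)) = (of_int (sign p) :: complex)"
      if "p permutes UNIV" for p :: "'n \<Rightarrow> 'n"
      by (simp only: sign_inverse[OF *[OF that]])
  qed simp
  then show ?thesis
    by (simp add: orth_projector_eqI)
qed


section \<open>Operators on a subspace, spans and commutants\<close>

text \<open>
  An operator on a subspace \<open>W\<close> with orthogonal projector \<open>P\<close> is represented by its extension by
  zero to the orthogonal complement of \<open>W\<close>, that is, by a matrix \<open>X\<close> with \<open>P X P = X\<close>. The identity
  of \<open>End W\<close> is then represented by \<open>P\<close>.
\<close>

definition End_on :: "(complex^'k) set \<Rightarrow> (complex^'k^'k) set"
  where "End_on W = {X. orth_projector W ** X ** orth_projector W = X}"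

lemma bij_betw_End_on:
  fixes W :: "(complex^'k) set"
  assumes "is_orth_projector P W"
  shows "bij_betw (\<lambda>X. restrict ((*v) X) W) (End_on W)
    {T \<in> W \<rightarrow>\<^sub>E W. (\<forall>x\<in>W. \<forall>y\<in>W. T (x + y) = T x + T y) \<and> (\<forall>c. \<forall>x\<in>W. T (c *s x) = c *s T x)}"
proof -
  have E: "X \<in> End_on W \<longleftrightarrow> P ** X ** P = X" for X
    by (simp add: End_on_def orth_projector_eqI[OF assms])
  have PW: "P *v x \<in> W" for x
    using assms by (auto simp: is_orth_projector_def)
  have fixW: "P *v x = x" if "x \<in> W" for x
    using that is_orth_projector_fixes[OF assms] by blast
  have PP: "P *v (P *v x) = P *v x" for x
    using PW fixW by blast
  have EX: "P *v (X *v (P *v x)) = X *v x" if "X \<in> End_on W" for X x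
    using that by (simp add: E matrix_vector_mul_assoc matrix_mul_assoc)
  have addW: "x + y \<in> W" if "x \<in> W" "y \<in> W" for x y
    using that by (metis PW fixW matrix_vector_right_distrib)
  have scaleW: "c *s x \<in> W" if "x \<in> W" for c x
    using that by (metis PW fixW vec.scale)
  show ?thesis
  proof (rule bij_betwI')
    fix X Y assume X: "X \<in> End_on W" and Y: "Y \<in> End_on W"
    show "(restrict ((*v) X) W = restrict ((*v) Y) W) = (X = Y)"
    proof
      assume "restrict ((*v) X) W = restrict ((*v) Y) W"
      then have "X *v (P *v x) = Y *v (P *v x)" for x
        using PW[of x] by (metis restrict_apply')
      then show "X = Y"
        unfolding matrix_eq using EX[OF X] EX[OF Y] by metis
    qed simp
  next
    fix X assume X: "X \<in> End_on W"
    have "X *v x \<in> W" for x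
      using EX[OF X] PW by metis
    then show "restrict ((*v) X) W \<in> {T \<in> W \<rightarrow>\<^sub>E W.
        (\<forall>x\<in>W. \<forall>y\<in>W. T (x + y) = T x + T y) \<and> (\<forall>c. \<forall>x\<in>W. T (c *s x) = c *s T x)}"
      by (auto simp: addW scaleW matrix_vector_right_distrib vec.scale)
  next
    fix T assume "T \<in> {T \<in> W \<rightarrow>\<^sub>E W.
        (\<forall>x\<in>W. \<forall>y\<in>W. T (x + y) = T x + T y) \<and> (\<forall>c. \<forall>x\<in>W. T (c *s x) = c *s T x)}"
    then have T: "T \<in> W \<rightarrow>\<^sub>E W" "\<And>x y. x \<in> W \<Longrightarrow> y \<in> W \<Longrightarrow> T (x + y) = T x + T y"
        "\<And>c x. x \<in> W \<Longrightarrow> T (c *s x) = c *s T x"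
      by auto
    define X where "X = matrix (\<lambda>x. T (P *v x))"
    have "Vector_Spaces.linear (*s) (*s) (\<lambda>x. T (P *v x))"
      by unfold_locales (simp_all add: matrix_vector_right_distrib vec.scale T PW)
    then have X: "X *v x = T (P *v x)" for x
      unfolding X_def by (rule matrix_works)
    have "T (P *v x) \<in> W" for x
      using T(1) PW by auto
    then have "X \<in> End_on W"
      unfolding E matrix_eq by (simp add: X PP fixW matrix_vector_mul_assoc[symmetric])
    moreover have "T = restrict ((*v) X) W"
      using T(1) by (auto simp: X fixW fun_eq_iff restrict_def PiE_def extensional_def)
    ultimately show "\<exists>X\<in>End_on W. T = restrict ((*v) X) W"
      by blast
  qed
qed

definition cscale :: "complex \<Rightarrow> complex^'n^'m \<Rightarrow> complex^'n^'m"
  where "cscale c A = (\<chi> i j. c * A $ i $ j)"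

interpretation cmat: vector_space "cscale :: complex \<Rightarrow> complex^'n^'m \<Rightarrow> complex^'n^'m"
  by unfold_locales (simp_all add: cscale_def vec_eq_iff algebra_simps)

definition Alg :: "(complex^'k^'k) set \<Rightarrow> (complex^'k^'k) set"
  where "Alg S = cmat.span S"

definition commutant_on :: "(complex^'k) set \<Rightarrow> (complex^'k^'k) set \<Rightarrow> (complex^'k^'k) set"
  where "commutant_on W S = {X \<in> End_on W. \<forall>Y\<in>S. X ** Y = Y ** X}"

text \<open>The compression of \<open>\<^bold>Q(H)\<close> to a subspace \<open>W\<close> of the tensor power:\<close>

definition compressed_tensor_powers ::
    "(complex^('n::finite \<Rightarrow> 'd::finite)) set \<Rightarrow> (complex^'d^'d) set \<Rightarrow> (complex^('n \<Rightarrow> 'd)^('n \<Rightarrow> 'd)) set"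
  where "compressed_tensor_powers W H =
    {orth_projector W ** tensor_power V ** orth_projector W | V. V \<in> H}"

text \<open>
  These sets are closed under multiplication, so that their linear span \<^const>\<open>Alg\<close> is an algebra:
\<close>

lemma tensor_power_mul:
  fixes U V :: "complex^'d::finite^'d"
  shows "(tensor_power U ** tensor_power V :: complex^('n::finite \<Rightarrow> 'd)^('n \<Rightarrow> 'd)) =
    tensor_power (U ** V)"
  by (simp add: tensor_power_def matrix_matrix_mult_def vec_eq_iff prod_sum_UNIV flip: prod.distrib)

lemma permute_factors_tensor_power:
  fixes V :: "complex^'d::finite^'d" and \<psi> :: "complex^('n::finite \<Rightarrow> 'd)"
  assumes p: "p permutes UNIV"
  shows "permute_factors p (tensor_power V *v \<psi>) = tensor_power V *v permute_factors p \<psi>"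
proof -
  have "(\<Sum>g\<in>UNIV. (\<Prod>i\<in>UNIV. V $ f (p i) $ g i) * \<psi> $ g) =
      (\<Sum>g\<in>UNIV. (\<Prod>i\<in>UNIV. V $ f i $ g i) * \<psi> $ (g \<circ> p))" for f :: "'n \<Rightarrow> 'd"
  proof (rule sum.reindex_bij_witness[where i = "\<lambda>g. g \<circ> p" and j = "\<lambda>g. g \<circ> inv_into UNIV p"])
    fix g :: "'n \<Rightarrow> 'd"
    show g: "g \<circ> inv_into UNIV p \<circ> p = g" "g \<circ> p \<circ> inv_into UNIV p = g"
      using permutes_inv_o[OF p] by (metis comp_assoc comp_id)+
    have "(\<Prod>i\<in>UNIV. V $ f i $ (g \<circ> inv_into UNIV p) i) = (\<Prod>i\<in>UNIV. V $ f (p i) $ g i)"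
      using prod.permute[OF p, of "\<lambda>i. V $ f i $ (g \<circ> inv_into UNIV p) i"]
      by (simp add: o_def permutes_inverses[OF p])
    then show "(\<Prod>i\<in>UNIV. V $ f i $ (g \<circ> inv_into UNIV p) i) * \<psi> $ (g \<circ> inv_into UNIV p \<circ> p) =
        (\<Prod>i\<in>UNIV. V $ f (p i) $ g i) * \<psi> $ g"
      by (simp only: g)
  qed auto
  then show ?thesis
    by (simp add: permute_factors_def tensor_power_def matrix_vector_mult_def vec_eq_iff)
qed

lemma compressed_tensor_powers_mul:
  fixes W :: "(complex^('n::finite \<Rightarrow> 'd::finite)) set"
  assumes W: "W \<in> {symmetric_subspace, antisymmetric_subspace}" and H: "subgroup H unitary_group"
    and X: "X \<in> compressed_tensor_powers W H" and Y: "Y \<in> compressed_tensor_powers W H"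
  shows "X ** Y \<in> compressed_tensor_powers W H"
proof -
  let ?P = "orth_projector W"
  obtain U V where U: "U \<in> H" "X = ?P ** tensor_power U ** ?P" and V: "V \<in> H" "Y = ?P ** tensor_power V ** ?P"
    using X Y by (auto simp: compressed_tensor_powers_def)
  have P: "is_orth_projector ?P W"
    using W is_orth_projector_symmetric is_orth_projector_antisymmetric by blast
  have "tensor_power V *v \<psi> \<in> W" if "\<psi> \<in> W" for \<psi>
    using W that
    by (auto simp: symmetric_subspace_def antisymmetric_subspace_def permute_factors_tensor_power vec.scale)
  then have *: "?P ** tensor_power V ** ?P = tensor_power V ** ?P"
    unfolding matrix_eq using is_orth_projector_fixes[OF P] P
    by (simp add: is_orth_projector_def flip: matrix_vector_mul_assoc) blast
  have PP: "?P ** ?P = ?P"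
    using P by (simp add: is_orth_projector_def)
  have "X ** Y = ?P ** tensor_power U ** (?P ** ?P ** tensor_power V ** ?P)"
    by (simp only: U V matrix_mul_assoc)
  also have "\<dots> = ?P ** tensor_power (U ** V) ** ?P"
    by (simp only: PP * matrix_mul_assoc flip: tensor_power_mul)
  moreover have "U ** V \<in> H"
    using subgroup.m_closed[OF H U(1) V(1)] by (simp add: unitary_group_def)
  ultimately show ?thesis
    by (auto simp: compressed_tensor_powers_def)
qed

end

theory Submission
  imports Defs
begin

text \<open>
  Put \<open>A = {a. a commutes with G'}\<close>, so that \<open>G\<close> is the set of unitaries in \<open>A\<close>, and let \<open>D\<close> be the
  span of the operators \<open>(V\<^sub>1 \<otimes> \<dots> \<otimes> V\<^sub>n) U\<^sub>p\<close> with \<open>V\<^sub>i \<in> G'\<close> and \<open>U\<^sub>p\<close> a permutation of the factors.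
  An operator commuting with \<open>D\<close> is a permutation invariant element of \<open>A \<otimes> \<dots> \<otimes> A\<close>, by polarization
  a combination of tensor powers \<open>a \<otimes> \<dots> \<otimes> a\<close> with \<open>a \<in> A\<close>, and hence of tensor powers of elements
  of \<open>G\<close>: a polynomial on \<open>A\<close> vanishing on the unitaries of \<open>A\<close> vanishes, as the Cayley transform shows.
  An operator \<open>X\<close> on \<open>W\<close> that commutes with the compressed tensor powers of \<open>G\<close> therefore commutes
  with the commutant of \<open>D\<close>, and so lies in \<open>D\<close> by the double commutant theorem. Compressing
  \<open>X = P X P\<close> absorbs the \<open>U\<^sub>p\<close> into signs and symmetrizes \<open>V\<^sub>1 \<otimes> \<dots> \<otimes> V\<^sub>n\<close>, so that polarization for
  the commutant of \<open>G\<close> turns \<open>X\<close> into a combination of compressed tensor powers of elements of \<open>G'\<close>.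
\<close>

section \<open>Complex matrices\<close>

lemma cscale_nth [simp]: "cscale c A $ i $ j = c * A $ i $ j"
  by (simp add: cscale_def)

lemma cscale_mult_left: "cscale c A ** B = cscale c (A ** B)"
  by (simp add: vec_eq_iff matrix_matrix_mult_def sum_distrib_left mult.assoc)

lemma cscale_mult_right: "A ** cscale c B = cscale c (A ** B)"
  by (simp add: vec_eq_iff matrix_matrix_mult_def sum_distrib_left mult.left_commute)

lemma conj_transpose_nth [simp]: "conj_transpose A $ i $ j = cnj (A $ j $ i)"
  by (simp add: conj_transpose_def)

lemma conj_transpose_add: "conj_transpose (A + B) = conj_transpose A + conj_transpose B"
  by (simp add: vec_eq_iff)

lemma conj_transpose_diff: "conj_transpose (A - B) = conj_transpose A - conj_transpose B"
  by (simp add: vec_eq_iff)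

lemma matrix_add_rdistrib: "(B + C) ** A = B ** A + C ** (A :: complex^'n^'m)"
  by (simp add: vec_eq_iff matrix_matrix_mult_def sum.distrib distrib_right)

lemma matrix_diff_ldistrib: "A ** (B - C) = A ** B - A ** C" for A :: "complex^'n^'m"
  by (simp add: vec_eq_iff matrix_matrix_mult_def sum_subtractf right_diff_distrib)

lemma matrix_diff_rdistrib: "(B - C) ** A = B ** A - C ** A" for A :: "complex^'n^'m"
  by (simp add: vec_eq_iff matrix_matrix_mult_def sum_subtractf left_diff_distrib)

lemma matrix_mult_sum_left: "A ** (\<Sum>i\<in>I. B i) = (\<Sum>i\<in>I. A ** B i)"
  for A :: "complex^'n^'m"
  by (induction I rule: infinite_finite_induct) (auto simp: matrix_add_ldistrib)

lemma matrix_mult_sum_right: "(\<Sum>i\<in>I. B i) ** A = (\<Sum>i\<in>I. B i ** A)"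
  for A :: "complex^'n^'m"
  by (induction I rule: infinite_finite_induct) (auto simp: matrix_add_rdistrib)

section \<open>The real inner product and adjoints\<close>

lemma inner_eq_Re_sum: "v \<bullet> w = Re (\<Sum>i\<in>UNIV. cnj (v $ i) * w $ i)" for v w :: "complex^'n"
  by (simp add: inner_vec_def inner_complex_def)

lemma inner_matrix_vector_mult: "(A *v v) \<bullet> w = v \<bullet> (conj_transpose A *v w)"
  for A :: "complex^'n^'m"
proof -
  have "(A *v v) \<bullet> w = Re (\<Sum>i\<in>UNIV. \<Sum>j\<in>UNIV. cnj (v $ j) * (cnj (A $ i $ j) * w $ i))"
    by (simp only: inner_eq_Re_sum matrix_vector_mult_def vec_lambda_beta cnj_sum
        complex_cnj_mult sum_distrib_right) (simp only: mult_ac)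
  also have "\<dots> = Re (\<Sum>j\<in>UNIV. \<Sum>i\<in>UNIV. cnj (v $ j) * (cnj (A $ i $ j) * w $ i))"
    by (subst sum.swap) simp
  also have "\<dots> = v \<bullet> (conj_transpose A *v w)"
    by (simp only: inner_eq_Re_sum matrix_vector_mult_def vec_lambda_beta conj_transpose_nth
        sum_distrib_left)
  finally show ?thesis .
qed

text \<open>Column by column this is the adjoint rule for vectors. It is the reason why the
  orthogonal projection onto a space stable under \<open>Y\<close> and its adjoint commutes with
  left multiplication by \<open>Y\<close>.\<close>

lemma inner_matrix_mult: "(Y ** A) \<bullet> B = A \<bullet> (conj_transpose Y ** B)"
  for Y :: "complex^'n^'m" and A :: "complex^'k^'n"
proof -
  have *: "C \<bullet> D = (\<Sum>k\<in>UNIV. column k C \<bullet> column k D)" for C D :: "complex^'k^'i::finite"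
    by (simp add: inner_vec_def column_def) (rule sum.swap)
  have **: "column k (C ** D) = C *v column k D"
    for C :: "complex^'i::finite^'j::finite" and D :: "complex^'k^'i" and k
    by (simp add: column_def matrix_matrix_mult_def matrix_vector_mult_def)
  show ?thesis by (simp add: * ** inner_matrix_vector_mult)
qed

definition matrix_unit :: "'m \<Rightarrow> 'n \<Rightarrow> complex^'n^'m" where
  "matrix_unit a b = (\<chi> i j. of_bool (i = a \<and> j = b))"

lemma sum_delta_of_bool [simp]:
  "(\<Sum>j\<in>UNIV. g j * of_bool (i = j)) = (g i :: complex)"
  "(\<Sum>j\<in>UNIV. g j * of_bool (j = i)) = (g i :: complex)" for i :: "'n::finite"
  by (simp_all add: of_bool_def if_distrib cong: if_cong)

lemma matrix_unit_expansion:
  "A = (\<Sum>a\<in>UNIV. \<Sum>b\<in>UNIV. cscale (A $ a $ b) (matrix_unit a b))"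
  by (simp add: vec_eq_iff matrix_unit_def of_bool_conj flip: mult.assoc)

text \<open>The real inner product suffices: multiplication by \<open>\<i>\<close> is an instance of the equivariance.\<close>

lemma equivariant_projection:
  fixes L :: "(complex^'k^'l) set"
  assumes L: "cmat.subspace L"
  shows "\<exists>T. Vector_Spaces.linear cscale cscale T \<and> range T \<subseteq> L \<and> (\<forall>A\<in>L. T A = A) \<and>
    (\<forall>Y. ((**) Y) ` L \<subseteq> L \<and> ((**) (conj_transpose Y)) ` L \<subseteq> L \<longrightarrow> (\<forall>A. T (Y ** A) = Y ** T A))"
proof -
  have sc: "cscale (of_real c) A = c *\<^sub>R A" for c and A :: "complex^'k^'l"
    by (simp add: vec_eq_iff complex_eq_iff)
  \<comment> \<open>A complex subspace is in particular a real one, so the orthogonal decomposition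
    of real Euclidean spaces applies to it.\<close>
  have subL: "subspace L"
    using cmat.subspace_0[OF L] cmat.subspace_add[OF L] cmat.subspace_scale[OF L]
    by (metis subspace_def sc)
  have "\<exists>B. B \<in> L \<and> (\<forall>C\<in>L. (A - B) \<bullet> C = 0)" for A
  proof -
    obtain B C where "B \<in> span L" "\<And>D. D \<in> span L \<Longrightarrow> orthogonal C D" "A = B + C"
      using orthogonal_subspace_decomp_exists[of L A] by metis
    moreover have "span L = L"
      using subL by (rule span_eq_iff[THEN iffD2])
    ultimately show ?thesis
      by (intro exI[of _ B]) (simp add: orthogonal_def)
  qed
  then obtain T where T: "\<And>A. T A \<in> L" "\<And>A C. C \<in> L \<Longrightarrow> (A - T A) \<bullet> C = 0"
    by metis
  \<comment> \<open>A residual orthogonal to \<open>L\<close> determines the projection.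
    Equivariance and additivity are verified through this criterion.\<close>
  have unique: "T A = B" if "B \<in> L" "\<And>C. C \<in> L \<Longrightarrow> (A - B) \<bullet> C = 0" for A B
  proof -
    have "T A - B \<in> L"
      using T(1) that(1) subL by (simp add: subspace_diff)
    then have "((A - B) - (A - T A)) \<bullet> (T A - B) = 0"
      unfolding inner_diff_left[of "A - B" "A - T A"] using T(2) that(2) by simp
    then have "(T A - B) \<bullet> (T A - B) = 0"
      by simp
    then show ?thesis
      by (simp only: inner_eq_zero_iff) simp
  qed
  have equiv: "T (Y ** A) = Y ** T A"
    if "\<And>B. B \<in> L \<Longrightarrow> Y ** B \<in> L" "\<And>B. B \<in> L \<Longrightarrow> conj_transpose Y ** B \<in> L" for Y A
  proof (rule unique)
    show "Y ** T A \<in> L"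
      using that(1) T(1) by blast
    show "(Y ** A - Y ** T A) \<bullet> B = 0" if "B \<in> L" for B
      unfolding matrix_diff_ldistrib[symmetric] inner_matrix_mult
      using T(2) \<open>B \<in> L \<Longrightarrow> conj_transpose Y ** B \<in> L\<close> that by blast
  qed
  have scale: "T (cscale c A) = cscale c (T A)" for c A
  proof -
    have "conj_transpose (cscale c (mat 1)) = cscale (cnj c) (mat 1 :: complex^'l^'l)"
      by (simp add: vec_eq_iff mat_def)
    then show ?thesis
      using equiv[of "cscale c (mat 1)" A] cmat.subspace_scale[OF L]
      by (simp add: cscale_mult_left)
  qed
  have add: "T (A + B) = T A + T B" for A B
  proof (rule unique)
    show "T A + T B \<in> L" using T(1) subL by (simp add: subspace_add)
    show "(A + B - (T A + T B)) \<bullet> C = 0" if "C \<in> L" for C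
    proof -
      have "A + B - (T A + T B) = (A - T A) + (B - T B)" by simp
      then show ?thesis
        using T(2)[OF that] by (simp only: inner_add_left)
    qed
  qed
  have "Vector_Spaces.linear cscale cscale T"
    by unfold_locales (simp_all add: add scale)
  moreover have "T A = A" if "A \<in> L" for A
    using that by (intro unique) simp_all
  ultimately show ?thesis
    using T(1) equiv by (intro exI[of _ T] conjI allI impI ballI) (auto simp: image_subset_iff)
qed

text \<open>Makes the entries of \<open>T A\<close> explicit linear forms in the entries of
  \<open>A\<close>. This provides the blocks in the double commutant theorem, the polynomiality of
  projected curves, and the kernel of a projection acting on one tensor factor.\<close>

lemma linear_matrix_unit_expansion:
  assumes "Vector_Spaces.linear cscale cscale T"
  shows "T A = (\<Sum>a\<in>UNIV. \<Sum>b\<in>UNIV. cscale (A $ a $ b) (T (matrix_unit a b)))"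
proof -
  interpret Vector_Spaces.linear cscale cscale T by fact
  show ?thesis
    by (subst matrix_unit_expansion[of A]) (simp add: sum scale)
qed


section \<open>Double commutant theorem\<close>

text \<open>The commutant in the full matrix algebra, a linear space;
  \<open>unitary_centralizer\<close> keeps only its unitary elements.\<close>

definition mat_commutant :: "(complex^'k^'k) set \<Rightarrow> (complex^'k^'k) set" where
  "mat_commutant S = {A. \<forall>B\<in>S. A ** B = B ** A}"

text \<open>
  The equivariant projection \<open>T\<close> onto the span of \<open>S\<close> is made up of the blocks \<open>M j l\<close>, which
  commute with \<open>S\<close> and hence with \<open>X\<close>, so that \<open>T X = X ** T 1 = X\<close>.
\<close>

lemma double_commutant:
  fixes S :: "(complex^'k^'k) set"
  assumes one: "mat 1 \<in> S"
    and mult: "\<And>A B. A \<in> S \<Longrightarrow> B \<in> S \<Longrightarrow> A ** B \<in> S"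
    and adj: "\<And>A. A \<in> S \<Longrightarrow> conj_transpose A \<in> S"
    and X: "X \<in> mat_commutant (mat_commutant S)"
  shows "X \<in> cmat.span S"
proof -
  obtain T where lin: "Vector_Spaces.linear cscale cscale T"
    and TS: "range T \<subseteq> cmat.span S" "\<forall>A\<in>cmat.span S. T A = A"
    and equiv: "\<forall>Y. ((**) Y) ` cmat.span S \<subseteq> cmat.span S \<and>
      ((**) (conj_transpose Y)) ` cmat.span S \<subseteq> cmat.span S \<longrightarrow> (\<forall>A. T (Y ** A) = Y ** T A)"
    using equivariant_projection[OF cmat.subspace_span[of S]] by (elim exE conjE)
  interpret Vector_Spaces.linear cscale cscale T by fact
  have span_mult: "Y ** B \<in> cmat.span S" if "Y \<in> S" "B \<in> cmat.span S" for Y B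
    using that(2)
  proof (induction rule: cmat.span_induct_alt)
    case base
    then show ?case by (simp add: cmat.span_zero)
  next
    case (step c A B)
    then have "Y ** A \<in> cmat.span S"
      using that(1) by (intro cmat.span_base mult)
    with step show ?case
      by (simp add: matrix_add_ldistrib cscale_mult_right cmat.span_add cmat.span_scale)
  qed
  have ST: "T (Y ** A) = Y ** T A" if "Y \<in> S" for Y A
    using that by (intro equiv[rule_format]) (auto simp: span_mult adj)
  \<comment> \<open>The block \<open>M j l\<close> turns column \<open>l\<close> of the argument
    into its contribution to column \<open>j\<close> of the image.\<close>
  define M where "M j l = (\<chi> a b. T (matrix_unit b l) $ a $ j)" for j l
  have M: "T A $ a $ j = (\<Sum>l\<in>UNIV. (M j l ** A) $ a $ l)" for A a j
    by (subst linear_matrix_unit_expansion[OF lin], subst sum.swap)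
      (simp add: M_def matrix_matrix_mult_def mult.commute)
  have "M j l \<in> mat_commutant S" for j l
    unfolding mat_commutant_def
  proof (intro CollectI ballI)
    fix Y assume Y: "Y \<in> S"
    have *: "Y ** matrix_unit c l = (\<Sum>b\<in>UNIV. cscale (Y $ b $ c) (matrix_unit b l))" for c l
      by (simp add: vec_eq_iff matrix_unit_def matrix_matrix_mult_def of_bool_conj
          flip: mult.assoc)
    have "Y ** T (matrix_unit c l) = (\<Sum>b\<in>UNIV. cscale (Y $ b $ c) (T (matrix_unit b l)))" for c
      by (simp only: ST[OF Y, symmetric] * sum scale)
    from this[symmetric] show "M j l ** Y = Y ** M j l"
      by (simp add: vec_eq_iff M_def matrix_matrix_mult_def mult.commute)
  qed
  then have comm: "M j l ** X = X ** M j l" for j l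
    using X by (simp add: mat_commutant_def)
  have "T X $ a $ j = (\<Sum>b\<in>UNIV. X $ a $ b * T (mat 1) $ b $ j)" for a j
  proof -
    have "T X $ a $ j = (\<Sum>l\<in>UNIV. \<Sum>b\<in>UNIV. X $ a $ b * M j l $ b $ l)"
      by (simp only: M comm) (simp add: matrix_matrix_mult_def)
    also have "\<dots> = (\<Sum>b\<in>UNIV. \<Sum>l\<in>UNIV. X $ a $ b * M j l $ b $ l)"
      by (rule sum.swap)
    also have "\<dots> = (\<Sum>b\<in>UNIV. X $ a $ b * T (mat 1) $ b $ j)"
      by (simp only: M[of "mat 1"] matrix_mul_rid sum_distrib_left)
    finally show ?thesis .
  qed
  then have "T X = X ** T (mat 1)"
    by (simp add: vec_eq_iff matrix_matrix_mult_def)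
  also have "T (mat 1) = mat 1"
    using one by (intro TS(2)[rule_format] cmat.span_base)
  finally have "T X = X"
    by simp
  then show ?thesis
    using TS(1) by (metis rangeI subsetD)
qed


section \<open>Polynomial curves\<close>

text \<open>A predicate on functions, so that introduction rules can carry it through sums, products
  and determinants of matrix-valued curves.\<close>

definition polyfun :: "(complex \<Rightarrow> complex) \<Rightarrow> bool" where
  "polyfun f \<longleftrightarrow> (\<exists>p. \<forall>s. f s = poly p s)"

named_theorems polyfun_intros

lemma polyfun_const [polyfun_intros]: "polyfun (\<lambda>_. c)"
  unfolding polyfun_def by (intro exI[of _ "[:c:]"]) auto

lemma polyfun_ident [polyfun_intros]: "polyfun (\<lambda>s. s)"
  unfolding polyfun_def by (intro exI[of _ "[:0, 1:]"]) auto

lemma polyfun_add [polyfun_intros]: "polyfun f \<Longrightarrow> polyfun g \<Longrightarrow> polyfun (\<lambda>s. f s + g s)"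
  unfolding polyfun_def by (metis poly_add)

lemma polyfun_diff [polyfun_intros]: "polyfun f \<Longrightarrow> polyfun g \<Longrightarrow> polyfun (\<lambda>s. f s - g s)"
  unfolding polyfun_def by (metis poly_diff)

lemma polyfun_mult [polyfun_intros]: "polyfun f \<Longrightarrow> polyfun g \<Longrightarrow> polyfun (\<lambda>s. f s * g s)"
  unfolding polyfun_def by (metis poly_mult)

lemma polyfun_sum [polyfun_intros]: "(\<And>i. i \<in> I \<Longrightarrow> polyfun (f i)) \<Longrightarrow> polyfun (\<lambda>s. \<Sum>i\<in>I. f i s)"
  by (induction I rule: infinite_finite_induct) (auto intro!: polyfun_const polyfun_add)

lemma polyfun_prod [polyfun_intros]: "(\<And>i. i \<in> I \<Longrightarrow> polyfun (f i)) \<Longrightarrow> polyfun (\<lambda>s. \<Prod>i\<in>I. f i s)"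
  by (induction I rule: infinite_finite_induct) (auto intro!: polyfun_const polyfun_mult)

lemma polyfun_det [polyfun_intros]:
  fixes M :: "complex \<Rightarrow> complex^'n^'n"
  assumes "\<And>i j. polyfun (\<lambda>s. M s $ i $ j)"
  shows "polyfun (\<lambda>s. det (M s))"
  unfolding det_def by (intro polyfun_intros assms)

lemma polyfun_matrix_mult [polyfun_intros]:
  fixes M :: "complex \<Rightarrow> complex^'m^'n" and N :: "complex \<Rightarrow> complex^'k^'m"
  assumes "\<And>i j. polyfun (\<lambda>s. M s $ i $ j)" "\<And>i j. polyfun (\<lambda>s. N s $ i $ j)"
  shows "polyfun (\<lambda>s. (M s ** N s) $ i $ j)"
  by (simp add: matrix_matrix_mult_def) (intro polyfun_intros assms)

lemma polyfun_tensor_power [polyfun_intros]: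
  fixes M :: "complex \<Rightarrow> complex^'d::finite^'d"
  assumes "\<And>i j. polyfun (\<lambda>s. M s $ i $ j)"
  shows "polyfun (\<lambda>s. tensor_power (M s) $ f $ g)"
  by (simp add: tensor_power_def) (intro polyfun_intros assms)

lemma polyfun_eq_0:
  assumes "polyfun f" "infinite S" "\<And>s. s \<in> S \<Longrightarrow> f s = 0"
  shows "f t = 0"
proof -
  obtain p where p: "\<And>s. f s = poly p s"
    using assms(1) by (auto simp: polyfun_def)
  have "S \<subseteq> {x. poly p x = 0}"
    using assms(3) p by auto
  then have "p = 0"
    using assms(2) poly_roots_finite finite_subset by blast
  with p show ?thesis by simp
qed

text \<open>With a linear projection \<open>T\<close> onto \<open>L\<close>, membership of
  \<open>M s\<close> in \<open>L\<close> means that all entries of \<open>M s - T (M s)\<close>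
  vanish. These are polynomials in \<open>s\<close> with infinitely many zeros.\<close>

lemma polyfun_mem_subspace:
  fixes M :: "complex \<Rightarrow> complex^'k^'l"
  assumes L: "cmat.subspace L" and M: "\<And>i j. polyfun (\<lambda>s. M s $ i $ j)"
    and S: "infinite S" "\<And>s. s \<in> S \<Longrightarrow> M s \<in> L"
  shows "M t \<in> L"
proof -
  obtain T where T: "Vector_Spaces.linear cscale cscale T" "range T \<subseteq> L" "\<forall>A\<in>L. T A = A"
    using equivariant_projection[OF L] by (elim exE conjE)
  have "polyfun (\<lambda>s. M s $ i $ j - T (M s) $ i $ j)" for i j
    by (subst linear_matrix_unit_expansion[OF T(1)]) (simp, intro polyfun_intros M)
  then have "M t $ i $ j - T (M t) $ i $ j = 0" for i j
    by (rule polyfun_eq_0[OF _ S(1)]) (simp add: S(2) T(3))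
  then have "M t = T (M t)"
    by (simp add: vec_eq_iff)
  then show ?thesis
    using T(2) by (metis rangeI subsetD)
qed

text \<open>Written with the determinants of Cramer's rule, which are polynomial in the entries of
  \<open>A\<close>. It replaces the inverse in the Cayley transform, where polynomial dependence is
  required.\<close>

definition adjugate :: "complex^'n^'n \<Rightarrow> complex^'n^'n" where
  "adjugate A = (\<chi> k l. det (\<chi> i j. if j = k then mat 1 $ i $ l else A $ i $ j))"

lemma polyfun_adjugate [polyfun_intros]:
  fixes M :: "complex \<Rightarrow> complex^'n^'n"
  assumes "\<And>i j. polyfun (\<lambda>s. M s $ i $ j)"
  shows "polyfun (\<lambda>s. adjugate (M s) $ k $ l)"
proof -
  have "polyfun (\<lambda>s. if j = k then mat 1 $ i $ l else M s $ i $ j)" for i j :: 'n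
    by (cases "j = k") (auto intro: assms polyfun_const)
  then show ?thesis
    by (simp add: adjugate_def) (intro polyfun_intros, simp)
qed

lemma det_neq_0_if_right_inverse:
  fixes A :: "'a::field^'n^'n"
  assumes "A ** B = mat 1"
  shows "det A \<noteq> 0"
  using assms by (metis det_I det_mul mult_zero_left zero_neq_one)

text \<open>Cramer's rule applied to each column of \<open>A ** B = mat 1\<close>.\<close>

lemma adjugate_eq_cscale_inverse:
  fixes A :: "complex^'n^'n"
  assumes "A ** B = mat 1"
  shows "adjugate A = cscale (det A) B"
proof -
  have "column l B = (\<chi> k. det (\<chi> i j. if j = k then column l (mat 1) $ i else A $ i $ j) / det A)" for l
  proof (subst cramer[symmetric])
    show "det A \<noteq> 0" using assms by (rule det_neq_0_if_right_inverse)
    have "A *v column l B = column l (A ** B)"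
      by (simp add: column_def matrix_matrix_mult_def matrix_vector_mult_def)
    then show "A *v column l B = column l (mat 1)"
      using assms by simp
  qed
  then have "B $ k $ l = adjugate A $ k $ l / det A" for k l
    by (simp add: column_def adjugate_def vec_eq_iff cong: if_cong)
  then show ?thesis
    using det_neq_0_if_right_inverse[OF assms] by (simp add: vec_eq_iff)
qed


section \<open>The Cayley transform\<close>

lemma mat_commutant_one: "mat 1 \<in> mat_commutant H"
  by (simp add: mat_commutant_def)

lemma mat_commutant_add: "A \<in> mat_commutant H \<Longrightarrow> B \<in> mat_commutant H \<Longrightarrow> A + B \<in> mat_commutant H"
  by (simp add: mat_commutant_def matrix_add_ldistrib matrix_add_rdistrib)

lemma mat_commutant_cscale: "A \<in> mat_commutant H \<Longrightarrow> cscale c A \<in> mat_commutant H"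
  by (simp add: mat_commutant_def cscale_mult_left cscale_mult_right)

lemma mat_commutant_mult: "A \<in> mat_commutant H \<Longrightarrow> B \<in> mat_commutant H \<Longrightarrow> A ** B \<in> mat_commutant H"
  by (simp add: mat_commutant_def) (metis matrix_mul_assoc)

lemma subspace_mat_commutant: "cmat.subspace (mat_commutant H)"
  by (intro cmat.subspaceI mat_commutant_add mat_commutant_cscale)
    (auto simp: mat_commutant_def)

text \<open>If \<open>A\<close> commutes with \<open>C\<close>, then
  \<open>B C = B C A B = B A C B = C B\<close>.\<close>

lemma mat_commutant_inverse:
  assumes "A \<in> mat_commutant H" "A ** B = mat 1"
  shows "B \<in> mat_commutant H"
proof -
  have BA: "B ** A = mat 1"
    using assms(2) matrix_left_right_inverse by blast
  have "B ** C = C ** B" if "C \<in> H" for C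
  proof -
    have "B ** C = B ** (C ** A) ** B"
      by (simp add: assms(2) flip: matrix_mul_assoc)
    also have "C ** A = A ** C"
      using assms(1) that by (simp add: mat_commutant_def)
    also have "B ** (A ** C) ** B = (B ** A) ** C ** B"
      by (simp only: matrix_mul_assoc)
    finally show ?thesis by (simp add: BA)
  qed
  then show ?thesis by (simp add: mat_commutant_def)
qed

lemma mat_commutant_conj_transpose:
  assumes "\<And>B. B \<in> H \<Longrightarrow> conj_transpose B \<in> H" "A \<in> mat_commutant H"
  shows "conj_transpose A \<in> mat_commutant H"
proof -
  have "conj_transpose A ** B = B ** conj_transpose A" if "B \<in> H" for B
  proof -
    have "conj_transpose (conj_transpose B ** A) = conj_transpose (A ** conj_transpose B)"
      using assms that by (simp add: mat_commutant_def)
    then show ?thesis by (simp add: conj_transpose_mul)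
  qed
  then show ?thesis by (simp add: mat_commutant_def)
qed

text \<open>If \<open>v = x v\<close>, then moving \<open>x\<close> across the inner product changes
  its sign, so \<open>v\<close> is orthogonal to itself. The kernel of \<open>1 - x\<close> is
  therefore trivial.\<close>

lemma skew_one_minus_invertible:
  fixes x :: "complex^'d^'d"
  assumes "conj_transpose x = - x"
  obtains B where "(mat 1 - x) ** B = mat 1"
proof -
  have "v = 0" if "(mat 1 - x) *v v = 0" for v
  proof -
    have v: "v = x *v v"
      using that by (simp add: matrix_vector_mult_diff_rdistrib)
    have "(x *v v) \<bullet> v = v \<bullet> (- x *v v)"
      by (simp only: inner_matrix_vector_mult assms)
    also have "- x *v v = - (x *v v)"
      by (simp add: vec_eq_iff matrix_vector_mult_def sum_negf)
    finally have "v \<bullet> v = - (v \<bullet> v)"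
      using v by simp
    then show "v = 0" by simp
  qed
  then obtain B where "B ** (mat 1 - x) = mat 1"
    using matrix_left_invertible_ker[of "mat 1 - x"] by blast
  then show ?thesis
    using that matrix_left_right_inverse by blast
qed

text \<open>The adjoint of \<open>1 + x\<close> is \<open>1 - x\<close>, and the two commute; hence
  \<open>V = (1 + x) B\<close>, with \<open>B\<close> the inverse of \<open>1 - x\<close>, is
  unitary. Multiplying by the determinant clears the denominator, so that the left-hand side is
  polynomial in \<open>x\<close>.\<close>

lemma cayley:
  fixes H :: "(complex^'d^'d) set"
  assumes x: "x \<in> mat_commutant H" "conj_transpose x = - x"
  obtains V where "V \<in> unitary_centralizer H"
    "(mat 1 + x) ** adjugate (mat 1 - x) = cscale (det (mat 1 - x)) V"
proof -
  obtain B where B: "(mat 1 - x) ** B = mat 1"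
    using skew_one_minus_invertible[OF x(2)] .
  define V where "V = (mat 1 + x) ** B"
  have minus: "mat 1 - x = mat 1 + cscale (-1) x"
    by (simp add: vec_eq_iff)
  have "mat 1 - x \<in> mat_commutant H"
    unfolding minus by (intro mat_commutant_add mat_commutant_one mat_commutant_cscale x)
  then have V: "V \<in> mat_commutant H"
    unfolding V_def
    by (intro mat_commutant_mult mat_commutant_add mat_commutant_one mat_commutant_inverse[OF _ B] x)
  have ct: "conj_transpose (mat 1 + x) = mat 1 - x" "conj_transpose (mat 1 - x) = mat 1 + x"
    by (simp_all add: conj_transpose_add conj_transpose_diff x(2))
  have comm: "(mat 1 - x) ** (mat 1 + x) = (mat 1 + x) ** (mat 1 - x)"
    by (simp add: matrix_add_ldistrib matrix_add_rdistrib matrix_diff_ldistrib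
        matrix_diff_rdistrib)
  have "conj_transpose V ** V = conj_transpose B ** ((mat 1 - x) ** (mat 1 + x)) ** B"
    by (simp only: V_def conj_transpose_mul ct matrix_mul_assoc)
  also have "\<dots> = (conj_transpose B ** (mat 1 + x)) ** ((mat 1 - x) ** B)"
    by (simp only: comm matrix_mul_assoc)
  also have "\<dots> = conj_transpose ((mat 1 - x) ** B)"
    unfolding conj_transpose_mul ct by (simp only: B matrix_mul_rid)
  finally have "conj_transpose V ** V = mat 1"
    by (simp add: B)
  then have "V \<in> carrier unitary_group"
    using matrix_left_right_inverse[of V] by (auto simp: unitary_group_def)
  with V have "V \<in> unitary_centralizer H"
    by (simp add: unitary_centralizer_def mat_commutant_def)
  moreover have "(mat 1 + x) ** adjugate (mat 1 - x) = cscale (det (mat 1 - x)) V"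
    by (simp add: adjugate_eq_cscale_inverse[OF B] cscale_mult_right V_def)
  ultimately show ?thesis by (rule that)
qed

section \<open>From tensor powers of unitaries to tensor powers of the whole commutant\<close>

lemma tensor_power_cscale:
  "(tensor_power (cscale c A) :: complex^('n::finite \<Rightarrow> 'd::finite)^('n \<Rightarrow> 'd)) =
    cscale (c ^ CARD('n)) (tensor_power A)"
  by (simp add: vec_eq_iff tensor_power_def prod.distrib)

text \<open>
  A polynomial vanishing on all skew-Hermitian \<open>x\<close> vanishes for all \<open>x = k + \<i> l\<close>, because it can be
  restricted to the complex line \<open>s \<mapsto> k + s l\<close>, whose real points are skew-Hermitian.
\<close>

lemma tensor_power_cayley_mem_span:
  fixes H :: "(complex^'d::finite^'d) set" and x :: "complex^'d^'d"
  defines "L \<equiv> cmat.span (tensor_power ` unitary_centralizer H) ::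
    (complex^('n::finite \<Rightarrow> 'd)^('n \<Rightarrow> 'd)) set"
  assumes adj: "\<And>B. B \<in> H \<Longrightarrow> conj_transpose B \<in> H" and x: "x \<in> mat_commutant H"
  shows "tensor_power ((mat 1 + x) ** adjugate (mat 1 - x)) \<in> L"
proof -
  \<comment> \<open>Both \<open>k\<close> and \<open>l\<close> are skew-Hermitian, and
    \<open>x = k + \<i> l\<close>. They stay in the commutant because \<open>H\<close> is closed
    under adjoints.\<close>
  define k where "k = cscale (1/2) (x + cscale (-1) (conj_transpose x))"
  define l where "l = cscale (- \<i> / 2) (x + conj_transpose x)"
  have kl: "k \<in> mat_commutant H" "l \<in> mat_commutant H"
    unfolding k_def l_def
    by (intro mat_commutant_cscale mat_commutant_add x mat_commutant_conj_transpose adj; assumption)+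
  define M where "M s = k + cscale s l" for s
  define N :: "complex \<Rightarrow> complex^('n \<Rightarrow> 'd)^('n \<Rightarrow> 'd)"
    where "N s = tensor_power ((mat 1 + M s) ** adjugate (mat 1 - M s))" for s
  have "N \<i> \<in> L"
  proof (rule polyfun_mem_subspace)
    show "cmat.subspace L" by (simp add: L_def)
    show "polyfun (\<lambda>s. N s $ i $ j)" for i j
      unfolding N_def M_def
      by (intro polyfun_intros; simp; intro polyfun_intros)
    show "infinite (range complex_of_real)"
      by (simp add: finite_image_iff inj_of_real infinite_UNIV_char_0)
    \<comment> \<open>At real \<open>s\<close> the Cayley transform applies to \<open>M s\<close>;
      the determinant contributes only a scalar, which the span absorbs.\<close>
    show "N s \<in> L" if "s \<in> range complex_of_real" for s
    proof -
      have "conj_transpose (M s) = - M s"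
        using that by (auto simp: vec_eq_iff M_def k_def l_def field_simps)
      moreover have "M s \<in> mat_commutant H"
        unfolding M_def by (intro mat_commutant_add mat_commutant_cscale kl)
      ultimately obtain V where "V \<in> unitary_centralizer H"
        "(mat 1 + M s) ** adjugate (mat 1 - M s) = cscale (det (mat 1 - M s)) V"
        using cayley by blast
      then show ?thesis
        by (simp add: N_def L_def tensor_power_cscale cmat.span_scale cmat.span_base)
    qed
  qed
  moreover have "M \<i> = x"
    by (simp add: vec_eq_iff M_def k_def l_def field_simps)
  ultimately show ?thesis by (simp add: N_def)
qed

text \<open>An eigenvalue cannot exceed an operator bound in modulus. The threshold is the absolute
  value of the bound, which makes \<open>r\<close> positive, so that the norm of \<open>r v\<close>
  is \<open>r\<close> times that of \<open>v\<close>.\<close>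

lemma mat_add_scalar_invertible:
  fixes y :: "complex^'d^'d"
  obtains K where "\<And>r. r > K \<Longrightarrow> \<exists>B. (y + mat (complex_of_real r)) ** B = mat 1"
proof -
  obtain K where K: "\<And>v. norm (y *v v) \<le> norm v * K"
    using bounded_linear.bounded[OF matrix_vector_mul_bounded_linear[of y]] by metis
  have "\<exists>B. (y + mat (complex_of_real r)) ** B = mat 1" if r: "r > \<bar>K\<bar>" for r
  proof -
    have "v = 0" if "(y + mat (complex_of_real r)) *v v = 0" for v
    proof -
      have "mat (complex_of_real r) *v v = r *\<^sub>R v"
        by (simp add: vec_eq_iff matrix_vector_mult_def mat_def scaleR_conv_of_real[where ?'a = complex]
            mult_delta_left)
      then have "y *v v = - (r *\<^sub>R v)"
        using that by (simp add: matrix_vector_mult_add_rdistrib eq_neg_iff_add_eq_0)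
      then have "r * norm v \<le> norm v * K"
        using K[of v] r by simp
      then have "norm v * (r - K) \<le> 0"
        by (simp add: algebra_simps)
      then show "v = 0"
        using r by (auto simp: mult_le_0_iff)
    qed
    then show ?thesis
      using matrix_left_invertible_ker matrix_left_right_inverse by blast
  qed
  then show ?thesis using that by blast
qed

text \<open>
  If \<open>-1\<close> is not an eigenvalue of \<open>y\<close>, then \<open>y = (1 + x) (1 - x)\<^sup>-\<^sup>1\<close> for \<open>x = (y - 1) (y + 1)\<^sup>-\<^sup>1\<close>.
  In general, this applies to all but finitely many points of the line \<open>s \<mapsto> y + s\<close>.
\<close>

lemma tensor_power_mem_span:
  fixes H :: "(complex^'d::finite^'d) set" and y :: "complex^'d^'d"
  assumes adj: "\<And>B. B \<in> H \<Longrightarrow> conj_transpose B \<in> H" and y: "y \<in> mat_commutant H"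
  shows "(tensor_power y :: complex^('n::finite \<Rightarrow> 'd)^('n \<Rightarrow> 'd)) \<in>
    cmat.span (tensor_power ` unitary_centralizer H)"
proof -
  let ?L = "cmat.span (tensor_power ` unitary_centralizer H) ::
    (complex^('n::finite \<Rightarrow> 'd)^('n \<Rightarrow> 'd)) set"
  obtain K where K: "\<And>r. r > K \<Longrightarrow> \<exists>B. (y + mat (complex_of_real r)) ** B = mat 1"
    using mat_add_scalar_invertible[of y] by metis
  define N where "N s = y + cscale s (mat 1)" for s
  have NH: "N s \<in> mat_commutant H" for s
    unfolding N_def by (intro mat_commutant_add y mat_commutant_cscale mat_commutant_one)
  have "tensor_power (N 0) \<in> ?L"
  proof (rule polyfun_mem_subspace[where M = "\<lambda>s. tensor_power (N s)"])
    show "polyfun (\<lambda>s. (tensor_power (N s) :: complex^('n \<Rightarrow> 'd)^('n \<Rightarrow> 'd)) $ i $ j)" for i j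
      unfolding N_def by (intro polyfun_intros; simp; intro polyfun_intros)
    \<comment> \<open>Invertibility is known only for large real parameters; this half-line is
      infinite, and polynomiality carries membership on to \<open>s = 0\<close>.\<close>
    have "inj_on (\<lambda>r. complex_of_real r) {K..}"
      by (simp add: inj_on_def)
    then show "infinite (complex_of_real ` {K..})"
      by (simp add: finite_image_iff infinite_Ici)
    show "tensor_power (N s) \<in> ?L" if "s \<in> complex_of_real ` {K..}" for s
    proof -
      from that obtain r where r: "s = of_real r" "r \<ge> K" by auto
      \<comment> \<open>The denominator of the inverse Cayley transform of \<open>N s\<close> is
        \<open>N (s + 1)\<close>. The shift also makes \<open>r + 1\<close> strictly larger than
        \<open>K\<close> at the end point \<open>r = K\<close>.\<close>
      have "N (s + 1) = y + mat (complex_of_real (r + 1))"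
        by (simp add: N_def r vec_eq_iff mat_def)
      then obtain B where B: "N (s + 1) ** B = mat 1"
        using K[of "r + 1"] r by auto
      then have BH: "B \<in> mat_commutant H"
        by (rule mat_commutant_inverse[OF NH])
      define x where "x = N (s - 1) ** B"
      have x: "x \<in> mat_commutant H"
        unfolding x_def by (intro mat_commutant_mult NH BH)
      have "mat 1 - x = (N (s + 1) - N (s - 1)) ** B"
        by (simp add: x_def B matrix_diff_rdistrib)
      also have "N (s + 1) - N (s - 1) = cscale 2 (mat 1)"
        by (simp add: N_def vec_eq_iff algebra_simps)
      finally have m: "mat 1 - x = cscale 2 B"
        by (simp add: cscale_mult_left)
      have "mat 1 + x = (N (s + 1) + N (s - 1)) ** B"
        by (simp add: x_def B matrix_add_rdistrib)
      also have "N (s + 1) + N (s - 1) = cscale 2 (N s)"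
        by (simp add: N_def vec_eq_iff algebra_simps)
      finally have p: "mat 1 + x = cscale 2 (N s ** B)"
        by (simp add: cscale_mult_left)
      have BN: "B ** N (s + 1) = mat 1"
        using B matrix_left_right_inverse by blast
      then have inv: "(mat 1 - x) ** cscale (1/2) (N (s + 1)) = mat 1"
        by (simp add: m cscale_mult_left cscale_mult_right)
      define c where "c = det (mat 1 - x)"
      have "c \<noteq> 0"
        unfolding c_def using inv by (rule det_neq_0_if_right_inverse)
      \<comment> \<open>The factor \<open>B\<close> of \<open>1 + x\<close> cancels against the
        inverse of \<open>1 - x\<close>, leaving \<open>N s\<close> up to the nonzero scalar
        \<open>c\<close>.\<close>
      have "(mat 1 + x) ** adjugate (mat 1 - x) = cscale c (N s ** (B ** N (s + 1)))"
        by (simp add: adjugate_eq_cscale_inverse[OF inv] p cscale_mult_left cscale_mult_right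
            matrix_mul_assoc c_def)
      also have "\<dots> = cscale c (N s)"
        by (simp add: BN)
      finally have "tensor_power (cscale c (N s)) \<in> ?L"
        using tensor_power_cayley_mem_span[OF adj x] by simp
      then have "cscale (1 / c ^ CARD('n)) (cscale (c ^ CARD('n)) (tensor_power (N s))) \<in> ?L"
        unfolding tensor_power_cscale by (rule cmat.span_scale)
      then show ?thesis
        using \<open>c \<noteq> 0\<close> by simp
    qed
  qed simp
  then show ?thesis
    by (simp add: N_def)
qed


section \<open>Polarization\<close>

definition tensor_op :: "('n::finite \<Rightarrow> complex^'d::finite^'d) \<Rightarrow> complex^('n \<Rightarrow> 'd)^('n \<Rightarrow> 'd)" where
  "tensor_op a = (\<chi> f g. \<Prod>i\<in>UNIV. a i $ f i $ g i)"

text \<open>Inclusion-exclusion: the indicator of \<open>R \<subseteq> T\<close> is a product over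
  the complement of \<open>T\<close>, and the sum is the expansion of the product of
  \<open>1 - of_bool (i \<notin> R)\<close> over all \<open>i\<close>.\<close>

lemma sum_sign_supersets:
  fixes R :: "'n::finite set"
  shows "(\<Sum>T\<in>UNIV. (-1) ^ card (- T) * of_bool (R \<subseteq> T)) = (of_bool (R = UNIV) :: complex)"
proof -
  have "(\<Prod>i\<in>- T. of_bool (i \<notin> R)) = (of_bool (R \<subseteq> T) :: complex)" for T
  proof (cases "R \<subseteq> T")
    case True
    then show ?thesis by (auto intro!: prod.neutral)
  next
    case False
    then show ?thesis by (auto intro!: prod_zero)
  qed
  then have "(\<Sum>T\<in>UNIV. (-1) ^ card (- T) * of_bool (R \<subseteq> T)) =
      (\<Sum>T\<in>Pow UNIV. (-1) ^ (CARD('n) - card T) * (\<Prod>i\<in>T. 1) *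
        (\<Prod>i\<in>UNIV - T. (of_bool (i \<notin> R) :: complex)))"
    by (simp add: Compl_eq_Diff_UNIV card_Diff_subset)
  also have "\<dots> = (\<Prod>i\<in>UNIV. 1 - of_bool (i \<notin> R))"
    by (rule prod_diff_conv_sum'[symmetric]) simp
  also have "\<dots> = of_bool (R = UNIV)"
  proof (cases "R = UNIV")
    case False
    then show ?thesis by (auto intro!: prod_zero)
  qed simp
  finally show ?thesis .
qed

text \<open>Expanding the tensor power of the sum over \<open>T\<close> gives one term for each map
  \<open>h\<close> with values in \<open>T\<close>. The alternating sum over \<open>T\<close>
  retains exactly the surjective \<open>h\<close>, which on a finite set are the
  permutations.\<close>

lemma polarization:
  fixes a :: "'n::finite \<Rightarrow> complex^'d::finite^'d"
  shows "(\<Sum>p | p permutes UNIV. tensor_op (a \<circ> p)) =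
    (\<Sum>T\<in>UNIV. cscale ((-1) ^ card (- T)) (tensor_power (\<Sum>j\<in>T. a j)))"
proof -
  have surj: "h permutes UNIV \<longleftrightarrow> range h = UNIV" for h :: "'n \<Rightarrow> 'n"
    by (metis UNIV_I bij_betw_def bij_imp_permutes finite finite_UNIV_surj_inj permutes_surj)
  have "(\<Sum>T\<in>UNIV. (-1) ^ card (- T) * (\<Prod>i\<in>UNIV. \<Sum>j\<in>T. a j $ f i $ g i)) =
      (\<Sum>h | h permutes UNIV. \<Prod>i\<in>UNIV. a (h i) $ f i $ g i)" for f g
  proof -
    have expand: "(\<Prod>i\<in>UNIV. \<Sum>j\<in>T. a j $ f i $ g i) =
        (\<Sum>h\<in>UNIV. of_bool (range h \<subseteq> T) * (\<Prod>i\<in>UNIV. a (h i) $ f i $ g i))" for T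
    proof -
      have range: "(\<Prod>i\<in>UNIV. of_bool (h i \<in> T)) = (of_bool (range h \<subseteq> T) :: complex)" for h :: "'n \<Rightarrow> 'n"
      proof (cases "range h \<subseteq> T")
        case True
        then show ?thesis by (auto intro!: prod.neutral)
      next
        case False
        then show ?thesis by (auto intro!: prod_zero)
      qed
      have *: "(\<Sum>j\<in>T. a j $ f i $ g i) = (\<Sum>j\<in>UNIV. of_bool (j \<in> T) * a j $ f i $ g i)" for i
        by (rule sum.mono_neutral_cong_left) auto
      show ?thesis
        by (simp only: * range prod_sum_UNIV prod.distrib)
    qed
    have "(\<Sum>T\<in>UNIV. (-1) ^ card (- T) * (\<Prod>i\<in>UNIV. \<Sum>j\<in>T. a j $ f i $ g i)) =
        (\<Sum>T\<in>UNIV. \<Sum>h\<in>UNIV. (-1) ^ card (- T) * of_bool (range h \<subseteq> T) *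
          (\<Prod>i\<in>UNIV. a (h i) $ f i $ g i))"
      by (simp only: expand sum_distrib_left mult.assoc)
    also have "\<dots> = (\<Sum>h\<in>UNIV. \<Sum>T\<in>UNIV. (-1) ^ card (- T) * of_bool (range h \<subseteq> T) *
          (\<Prod>i\<in>UNIV. a (h i) $ f i $ g i))"
      by (rule sum.swap)
    also have "\<dots> = (\<Sum>h\<in>UNIV. of_bool (range h = UNIV) * (\<Prod>i\<in>UNIV. a (h i) $ f i $ g i))"
      by (simp only: sum_sign_supersets flip: sum_distrib_right)
    also have "\<dots> = (\<Sum>h | h permutes UNIV. \<Prod>i\<in>UNIV. a (h i) $ f i $ g i)"
      by (rule sum.mono_neutral_cong_right) (auto simp: surj)
    finally show ?thesis .
  qed
  then show ?thesis
    by (simp add: vec_eq_iff tensor_op_def tensor_power_def)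
qed

text \<open>Polarization produces tensor powers of partial sums of the \<open>a j\<close>. These
  sums stay in the commutant, a linear space, so \<open>tensor_power_mem_span\<close> applies to
  each of them.\<close>

lemma sum_permutations_tensor_op_mem_span:
  fixes H :: "(complex^'d::finite^'d) set" and a :: "'n::finite \<Rightarrow> complex^'d^'d"
  assumes adj: "\<And>B. B \<in> H \<Longrightarrow> conj_transpose B \<in> H" and a: "\<And>i. a i \<in> mat_commutant H"
  shows "(\<Sum>p | p permutes UNIV. tensor_op (a \<circ> p)) \<in> cmat.span (tensor_power ` unitary_centralizer H)"
  unfolding polarization
  by (intro cmat.span_sum cmat.span_scale tensor_power_mem_span[OF adj]
      cmat.subspace_sum[OF subspace_mat_commutant] a)


section \<open>Local operators and permutations of the factors\<close>

definition perm_matrix :: "('n::finite \<Rightarrow> 'n) \<Rightarrow> complex^('n \<Rightarrow> 'd::finite)^('n \<Rightarrow> 'd)" where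
  "perm_matrix p = (\<chi> f g. of_bool (g = f \<circ> p))"

lemma perm_matrix_mult_nth: "(perm_matrix p ** A) $ f $ g = A $ (f \<circ> p) $ g"
  by (simp add: perm_matrix_def matrix_matrix_mult_def of_bool_def mult_delta_left)

lemma perm_matrix_vector_mult: "perm_matrix p *v \<psi> = permute_factors p \<psi>"
  by (simp add: perm_matrix_def permute_factors_def matrix_vector_mult_def vec_eq_iff of_bool_def
      mult_delta_left)

lemma comp_inv_eq_iff: "p permutes UNIV \<Longrightarrow> g = f \<circ> p \<longleftrightarrow> f = g \<circ> inv_into UNIV p"
  using permutes_inv_o[of p UNIV] by (metis comp_assoc comp_id)

lemma mult_perm_matrix_nth:
  assumes "p permutes UNIV"
  shows "(A ** perm_matrix p) $ f $ g = A $ f $ (g \<circ> inv_into UNIV p)"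
  by (simp add: perm_matrix_def matrix_matrix_mult_def of_bool_def mult_delta_right
      comp_inv_eq_iff[OF assms])

lemma perm_matrix_id: "perm_matrix id = mat 1"
  by (simp add: perm_matrix_def mat_def vec_eq_iff)

lemma perm_matrix_mult: "perm_matrix p ** perm_matrix q = perm_matrix (p \<circ> q)"
  by (simp add: vec_eq_iff perm_matrix_mult_nth) (simp add: perm_matrix_def o_assoc)

lemma conj_transpose_perm_matrix:
  "p permutes UNIV \<Longrightarrow> conj_transpose (perm_matrix p) = perm_matrix (inv_into UNIV p)"
  by (simp add: vec_eq_iff perm_matrix_def comp_inv_eq_iff)

lemma tensor_op_mult: "tensor_op a ** tensor_op b = tensor_op (\<lambda>i. a i ** b i)"
  by (simp add: tensor_op_def matrix_matrix_mult_def vec_eq_iff prod_sum_UNIV flip: prod.distrib)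

lemma conj_transpose_tensor_op: "conj_transpose (tensor_op a) = tensor_op (\<lambda>i. conj_transpose (a i))"
  by (simp add: tensor_op_def vec_eq_iff)

lemma tensor_op_one: "tensor_op (\<lambda>_. mat 1) = mat 1"
proof -
  have "(\<Prod>i\<in>UNIV. if f i = g i then 1 else 0) = (if f = g then 1 else 0 :: complex)"
    for f g :: "'a \<Rightarrow> 'b"
  proof (cases "f = g")
    case False
    then show ?thesis by (auto intro!: prod_zero)
  qed simp
  then show ?thesis by (simp add: tensor_op_def mat_def vec_eq_iff)
qed

lemma tensor_op_permute_nth:
  assumes p: "p permutes UNIV"
  shows "tensor_op a $ (f \<circ> p) $ (g \<circ> p) = tensor_op (a \<circ> inv_into UNIV p) $ f $ g"
  using prod.permute[OF p, of "\<lambda>i. a (inv_into UNIV p i) $ f i $ g i"]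
  by (simp add: tensor_op_def o_def permutes_inverses[OF p])

text \<open>Moving a permutation past a product operator relabels its factors; this underlies the
  closure of \<open>local_perm_ops\<close> under products and adjoints.\<close>

lemma perm_matrix_tensor_op:
  assumes p: "p permutes UNIV"
  shows "perm_matrix p ** tensor_op a = tensor_op (a \<circ> inv_into UNIV p) ** perm_matrix p"
proof -
  have "tensor_op a $ (f \<circ> p) $ g = tensor_op (a \<circ> inv_into UNIV p) $ f $ (g \<circ> inv_into UNIV p)" for f g
  proof -
    have "g \<circ> inv_into UNIV p \<circ> p = g"
      using comp_inv_eq_iff[OF p, of g "g \<circ> inv_into UNIV p"] by simp
    then show ?thesis
      using tensor_op_permute_nth[OF p, of a f "g \<circ> inv_into UNIV p"] by simp
  qed
  then show ?thesis
    by (simp add: vec_eq_iff perm_matrix_mult_nth mult_perm_matrix_nth[OF p])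
qed

text \<open>For \<open>H\<close> containing the identity and closed under products and adjoints,
  this set inherits these properties, as the double commutant theorem asks.\<close>

definition local_perm_ops ::
    "(complex^'d::finite^'d) set \<Rightarrow> (complex^('n::finite \<Rightarrow> 'd)^('n \<Rightarrow> 'd)) set" where
  "local_perm_ops H = {tensor_op a ** perm_matrix p | a p. range a \<subseteq> H \<and> p permutes UNIV}"

lemma local_perm_opsI:
  "(\<And>i. a i \<in> H) \<Longrightarrow> p permutes UNIV \<Longrightarrow> tensor_op a ** perm_matrix p \<in> local_perm_ops H"
  unfolding local_perm_ops_def by blast

lemma tensor_op_mem_local_perm_ops: "(\<And>i. a i \<in> H) \<Longrightarrow> tensor_op a \<in> local_perm_ops H"
  using local_perm_opsI[of a H id] by (simp add: perm_matrix_id permutes_id)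

lemma perm_matrix_mem_local_perm_ops:
  "mat 1 \<in> H \<Longrightarrow> p permutes UNIV \<Longrightarrow> perm_matrix p \<in> local_perm_ops H"
  using local_perm_opsI[of "\<lambda>_. mat 1" H p] by (simp add: tensor_op_one)

lemma local_perm_ops_mult:
  assumes H: "\<And>A B. A \<in> H \<Longrightarrow> B \<in> H \<Longrightarrow> A ** B \<in> H"
    and "X \<in> local_perm_ops H" "Y \<in> local_perm_ops H"
  shows "X ** Y \<in> local_perm_ops H"
proof -
  obtain a p b q where X: "X = tensor_op a ** perm_matrix p" "range a \<subseteq> H" "p permutes UNIV"
    and Y: "Y = tensor_op b ** perm_matrix q" "range b \<subseteq> H" "q permutes UNIV"
    using assms(2,3) unfolding local_perm_ops_def by blast
  have "X ** Y = tensor_op a ** (perm_matrix p ** tensor_op b) ** perm_matrix q"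
    by (simp only: X Y matrix_mul_assoc)
  also have "\<dots> = (tensor_op a ** tensor_op (b \<circ> inv_into UNIV p)) ** (perm_matrix p ** perm_matrix q)"
    by (simp only: perm_matrix_tensor_op[OF X(3)] matrix_mul_assoc)
  also have "\<dots> = tensor_op (\<lambda>i. a i ** (b \<circ> inv_into UNIV p) i) ** perm_matrix (p \<circ> q)"
    by (simp only: tensor_op_mult perm_matrix_mult)
  also have "\<dots> \<in> local_perm_ops H"
    using X Y by (intro local_perm_opsI H permutes_compose) auto
  finally show ?thesis .
qed

lemma local_perm_ops_conj_transpose:
  assumes H: "\<And>A. A \<in> H \<Longrightarrow> conj_transpose A \<in> H" and "X \<in> local_perm_ops H"
  shows "conj_transpose X \<in> local_perm_ops H"
proof -
  obtain a p where X: "X = tensor_op a ** perm_matrix p" "range a \<subseteq> H" "p permutes UNIV"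
    using assms(2) unfolding local_perm_ops_def by blast
  let ?q = "inv_into UNIV p"
  have q: "?q permutes UNIV"
    using X(3) by (rule permutes_inv)
  have "conj_transpose X = tensor_op ((\<lambda>i. conj_transpose (a i)) \<circ> inv_into UNIV ?q) ** perm_matrix ?q"
    by (simp only: X conj_transpose_mul conj_transpose_perm_matrix[OF X(3)] conj_transpose_tensor_op
        perm_matrix_tensor_op[OF q])
  also have "\<dots> \<in> local_perm_ops H"
    using X(2) by (intro local_perm_opsI q) (auto intro: H)
  finally show ?thesis .
qed

text \<open>Here \<open>\<epsilon>\<close> is the kernel of an operator acting on a single tensor factor.\<close>

lemma slotwise_projection:
  fixes x :: "('n::finite \<Rightarrow> 'e::finite) \<Rightarrow> complex"
  assumes "\<And>i h. x h = (\<Sum>e\<in>UNIV. x (h(i := e)) * \<epsilon> e (h i))"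
  shows "x h = (\<Sum>k\<in>UNIV. x k * (\<Prod>i\<in>UNIV. \<epsilon> (k i) (h i)))"
proof -
  \<comment> \<open>Induction on the set \<open>S\<close> of slots in which the kernel has been
    inserted; the remaining slots carry a Kronecker delta.\<close>
  have "x h = (\<Sum>k\<in>UNIV. x k * (\<Prod>i\<in>UNIV. if i \<in> S then \<epsilon> (k i) (h i) else of_bool (k i = h i)))"
    (is "_ = ?R S h") for S h
  proof (induction S arbitrary: h rule: finite_induct[OF finite])
    case 1
    have "(\<Prod>i\<in>UNIV. of_bool (k i = h i)) = (of_bool (k = h) :: complex)" for k
    proof (cases "k = h")
      case False
      then show ?thesis by (auto intro!: prod_zero)
    qed simp
    then show ?case by (simp del: of_bool_eq_iff)
  next
    case (2 j S)
    \<comment> \<open>The delta of slot \<open>j\<close> is split off as \<open>k j = e\<close>, so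
      that the sum over \<open>e\<close> leaves the kernel value
      \<open>\<epsilon> (k j) (h j)\<close> in its place.\<close>
    have upd: "(\<Prod>i\<in>UNIV. if i \<in> S then \<epsilon> (k i) ((h(j := e)) i) else of_bool (k i = (h(j := e)) i)) =
        of_bool (k j = e) * (\<Prod>i\<in>UNIV - {j}. if i \<in> S then \<epsilon> (k i) (h i) else of_bool (k i = h i))"
      for k e
      by (subst prod.remove[of _ j]) (use 2 in \<open>auto intro!: prod.cong cong: if_cong\<close>)
    have "x h = (\<Sum>e\<in>UNIV. ?R S (h(j := e)) * \<epsilon> e (h j))"
      by (simp only: 2(3)[symmetric]) (rule assms)
    also have "\<dots> = (\<Sum>e\<in>UNIV. \<Sum>k\<in>UNIV. of_bool (k j = e) * (x k *
        (\<Prod>i\<in>UNIV - {j}. if i \<in> S then \<epsilon> (k i) (h i) else of_bool (k i = h i)) * \<epsilon> e (h j)))"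
      unfolding upd by (simp only: sum_distrib_left sum_distrib_right mult_ac)
    also have "\<dots> = (\<Sum>k\<in>UNIV. \<Sum>e\<in>UNIV. of_bool (k j = e) * (x k *
        (\<Prod>i\<in>UNIV - {j}. if i \<in> S then \<epsilon> (k i) (h i) else of_bool (k i = h i)) * \<epsilon> e (h j)))"
      by (rule sum.swap)
    also have "\<dots> = (\<Sum>k\<in>UNIV. x k *
        (\<Prod>i\<in>UNIV - {j}. if i \<in> S then \<epsilon> (k i) (h i) else of_bool (k i = h i)) * \<epsilon> (k j) (h j))"
      by (simp add: of_bool_def mult_delta_left)
    also have "\<dots> = ?R (insert j S) h"
    proof (intro sum.cong refl)
      fix k
      have "(\<Prod>i\<in>UNIV - {j}. if i \<in> S then \<epsilon> (k i) (h i) else of_bool (k i = h i)) =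
        (\<Prod>i\<in>UNIV - {j}. if i \<in> insert j S then \<epsilon> (k i) (h i) else of_bool (k i = h i))"
        by (intro prod.cong) auto
      then show "x k * (\<Prod>i\<in>UNIV - {j}. if i \<in> S then \<epsilon> (k i) (h i) else of_bool (k i = h i)) *
          \<epsilon> (k j) (h j) =
        x k * (\<Prod>i\<in>UNIV. if i \<in> insert j S then \<epsilon> (k i) (h i) else of_bool (k i = h i))"
        by (subst (2) prod.remove[of _ j]) (simp_all add: mult_ac)
    qed
    finally show ?case .
  qed
  from this[of h UNIV] show ?thesis by simp
qed

text \<open>An operator that is \<open>V\<close> on factor \<open>i\<close> and the identity
  elsewhere only links indices that agree off \<open>i\<close>, so the sums collapse to sums over
  the value at \<open>i\<close>.\<close>

lemma sum_mult_slot_op: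
  fixes V :: "complex^'d::finite^'d" and F :: "('n::finite \<Rightarrow> 'd) \<Rightarrow> complex"
  shows "(\<Sum>h\<in>UNIV. F h * tensor_op ((\<lambda>_. mat 1)(i := V)) $ h $ g) =
      (\<Sum>b\<in>UNIV. F (g(i := b)) * V $ b $ g i)"
    and "(\<Sum>h\<in>UNIV. tensor_op ((\<lambda>_. mat 1)(i := V)) $ g $ h * F h) =
      (\<Sum>b\<in>UNIV. V $ g i $ b * F (g(i := b)))"
proof -
  have nth: "tensor_op ((\<lambda>_. mat 1)(i := V)) $ h $ k =
      (if \<forall>j. j \<noteq> i \<longrightarrow> h j = k j then V $ h i $ k i else 0)" for h k
  proof (cases "\<forall>j. j \<noteq> i \<longrightarrow> h j = k j")
    case True
    have "tensor_op ((\<lambda>_. mat 1)(i := V)) $ h $ k =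
      V $ h i $ k i * (\<Prod>j\<in>UNIV - {i}. mat 1 $ h j $ k j)"
      by (simp add: tensor_op_def prod.remove[of _ i] cong: prod.cong_simp)
    also have "(\<Prod>j\<in>UNIV - {i}. mat 1 $ h j $ k j) = (1 :: complex)"
      using True by (intro prod.neutral) (auto simp: mat_def)
    finally show ?thesis
      by (simp only: if_P[OF True] mult_1_right)
  next
    case False
    then show ?thesis
      by (auto simp: tensor_op_def mat_def intro!: prod_zero)
  qed
  have reindex: "(\<Sum>h\<in>UNIV. if \<forall>j. j \<noteq> i \<longrightarrow> h j = g j then Q h else 0) = (\<Sum>b\<in>UNIV. Q (g(i := b)))"
    for Q :: "('n \<Rightarrow> 'd) \<Rightarrow> complex"
  proof -
    have "(\<Sum>h\<in>UNIV. if \<forall>j. j \<noteq> i \<longrightarrow> h j = g j then Q h else 0) =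
      (\<Sum>h | \<forall>j. j \<noteq> i \<longrightarrow> h j = g j. Q h)"
      by (simp add: sum.inter_filter[symmetric])
    also have "\<dots> = (\<Sum>b\<in>UNIV. Q (g(i := b)))"
      by (rule sum.reindex_bij_witness[of _ "\<lambda>b. g(i := b)" "\<lambda>h. h i"])
        (auto simp: fun_eq_iff intro!: arg_cong[where f = Q])
    finally show ?thesis .
  qed
  show "(\<Sum>h\<in>UNIV. F h * tensor_op ((\<lambda>_. mat 1)(i := V)) $ h $ g) =
      (\<Sum>b\<in>UNIV. F (g(i := b)) * V $ b $ g i)"
    using reindex[of "\<lambda>h. F h * V $ h i $ g i"] by (simp add: nth if_distrib cong: if_cong)
  show "(\<Sum>h\<in>UNIV. tensor_op ((\<lambda>_. mat 1)(i := V)) $ g $ h * F h) =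
      (\<Sum>b\<in>UNIV. V $ g i $ b * F (g(i := b)))"
    using reindex[of "\<lambda>h. V $ g i $ h i * F h"]
    by (simp add: nth eq_commute[of "g _"] mult_delta_left)
qed

text \<open>Freezing the indices of all factors but \<open>i\<close> cuts a block out of
  \<open>X\<close>. Commutation of \<open>X\<close> with \<open>V\<close> acting on factor
  \<open>i\<close> alone restricts to commutation of this block with \<open>V\<close>.\<close>

lemma slot_mem_mat_commutant:
  fixes X :: "complex^('n::finite \<Rightarrow> 'd::finite)^('n \<Rightarrow> 'd)"
  assumes one: "mat 1 \<in> H" and X: "X \<in> mat_commutant (local_perm_ops H)"
  shows "(\<chi> a b. X $ (f(i := a)) $ (g(i := b))) \<in> mat_commutant H"
  unfolding mat_commutant_def
proof (intro CollectI ballI)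
  fix V assume V: "V \<in> H"
  let ?V = "tensor_op ((\<lambda>_. mat 1)(i := V))"
  have "?V \<in> local_perm_ops H"
    using one V by (intro tensor_op_mem_local_perm_ops) auto
  then have "X ** ?V = ?V ** X"
    using X by (simp add: mat_commutant_def)
  then have "(X ** ?V) $ (f(i := a)) $ (g(i := b)) = (?V ** X) $ (f(i := a)) $ (g(i := b))" for a b
    by simp
  then show "(\<chi> a b. X $ (f(i := a)) $ (g(i := b))) ** V = V ** (\<chi> a b. X $ (f(i := a)) $ (g(i := b)))"
    by (simp add: vec_eq_iff matrix_matrix_mult_def sum_mult_slot_op)
qed

text \<open>All one-factor blocks of \<open>X\<close> lie in the commutant of \<open>H\<close>, so
  projecting onto it in every slot fixes \<open>X\<close> and writes it as a combination of product
  operators with factors in that commutant. Permutation invariance symmetrizes them, and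
  polarization applies.\<close>

lemma mat_commutant_local_perm_ops:
  fixes X :: "complex^('n::finite \<Rightarrow> 'd::finite)^('n \<Rightarrow> 'd)"
  assumes one: "mat 1 \<in> H" and adj: "\<And>B. B \<in> H \<Longrightarrow> conj_transpose B \<in> H"
    and X: "X \<in> mat_commutant (local_perm_ops H)"
  shows "X \<in> cmat.span (tensor_power ` unitary_centralizer H)"
proof -
  let ?L = "cmat.span (tensor_power ` unitary_centralizer H) ::
    (complex^('n::finite \<Rightarrow> 'd)^('n \<Rightarrow> 'd)) set"
  obtain T where T: "Vector_Spaces.linear cscale cscale T" "range T \<subseteq> mat_commutant H"
    "\<forall>A\<in>mat_commutant H. T A = A"
    using equivariant_projection[OF subspace_mat_commutant[of H]] by (elim exE conjE)
  \<comment> \<open>Indexed by pairs, \<open>E\<close> is the kernel of \<open>T\<close> on one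
    factor, and \<open>x\<close> is \<open>X\<close> read as a tensor with one pair of row and
    column index per factor.\<close>
  define E where "E = (\<lambda>(a, b). T (matrix_unit a b))"
  define x where "x h = X $ (fst \<circ> h) $ (snd \<circ> h)" for h
  have x: "x h = (\<Sum>k\<in>UNIV. x k * (\<Prod>i\<in>UNIV. E (k i) $ fst (h i) $ snd (h i)))" for h
  proof (rule slotwise_projection)
    fix i and h :: "'n \<Rightarrow> 'd \<times> 'd"
    let ?Y = "\<chi> a b. X $ ((fst \<circ> h)(i := a)) $ ((snd \<circ> h)(i := b))"
    have "?Y = T ?Y"
      using slot_mem_mat_commutant[OF one X] T(3) by simp
    also have "T ?Y = (\<Sum>a\<in>UNIV. \<Sum>b\<in>UNIV. cscale (?Y $ a $ b) (T (matrix_unit a b)))"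
      by (rule linear_matrix_unit_expansion[OF T(1)])
    finally have "?Y $ fst (h i) $ snd (h i) =
        (\<Sum>a\<in>UNIV. \<Sum>b\<in>UNIV. cscale (?Y $ a $ b) (T (matrix_unit a b))) $ fst (h i) $ snd (h i)"
      by (rule arg_cong)
    moreover have "(fst \<circ> h)(i := fst (h i)) = fst \<circ> h" "(snd \<circ> h)(i := snd (h i)) = snd \<circ> h"
      by (simp_all add: fun_eq_iff)
    moreover have "fst \<circ> h(i := e) = (fst \<circ> h)(i := fst e)" "snd \<circ> h(i := e) = (snd \<circ> h)(i := snd e)"
      for e by (simp_all add: fun_eq_iff)
    ultimately show "x h = (\<Sum>e\<in>UNIV. x (h(i := e)) * E e $ fst (h i) $ snd (h i))"
      by (simp add: x_def E_def sum.cartesian_product case_prod_beta' flip: UNIV_Times_UNIV)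
  qed
  have expand: "X $ f $ g = (\<Sum>k\<in>UNIV. x k * tensor_op (E \<circ> k) $ f $ g)" for f g
    using x[of "\<lambda>i. (f i, g i)"] by (simp add: x_def tensor_op_def o_def)
  have perm: "X $ (f \<circ> p) $ (g \<circ> p) = X $ f $ g" if p: "p permutes UNIV" for p f g
  proof -
    have "X ** perm_matrix p = perm_matrix p ** X"
      using X perm_matrix_mem_local_perm_ops[OF one p] by (simp add: mat_commutant_def)
    then have "(X ** perm_matrix p) $ f $ (g \<circ> p) = (perm_matrix p ** X) $ f $ (g \<circ> p)"
      by simp
    moreover have "g \<circ> p \<circ> inv_into UNIV p = g"
      using comp_inv_eq_iff[OF p, of "g \<circ> p" g] by simp
    ultimately show ?thesis
      by (simp add: perm_matrix_mult_nth mult_perm_matrix_nth[OF p])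
  qed
  \<comment> \<open>Summing over all permutations multiplies the invariant \<open>X\<close> by the
    factorial and symmetrizes each product operator.\<close>
  have "cscale (fact CARD('n)) X = (\<Sum>k\<in>UNIV. cscale (x k) (\<Sum>p | p permutes UNIV. tensor_op (E \<circ> k \<circ> p)))"
  proof -
    have "fact CARD('n) * X $ f $ g = (\<Sum>k\<in>UNIV. x k * (\<Sum>p | p permutes UNIV. tensor_op (E \<circ> k \<circ> p) $ f $ g))"
      for f g
    proof -
      have "fact CARD('n) * X $ f $ g = (\<Sum>p | p permutes (UNIV :: 'n set). X $ (f \<circ> p) $ (g \<circ> p))"
        by (simp add: perm card_permutations)
      also have "\<dots> = (\<Sum>p | p permutes (UNIV :: 'n set). \<Sum>k\<in>UNIV.
          x k * tensor_op (E \<circ> k \<circ> inv_into UNIV p) $ f $ g)"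
        by (intro sum.cong refl) (simp add: expand tensor_op_permute_nth)
      also have "\<dots> = (\<Sum>p | p permutes (UNIV :: 'n set). \<Sum>k\<in>UNIV.
          x k * tensor_op (E \<circ> k \<circ> p) $ f $ g)"
        by (rule sum_permutations_inverse[symmetric])
      also have "\<dots> = (\<Sum>k\<in>UNIV. \<Sum>p | p permutes (UNIV :: 'n set).
          x k * tensor_op (E \<circ> k \<circ> p) $ f $ g)"
        by (rule sum.swap)
      finally show ?thesis
        by (simp only: sum_distrib_left)
    qed
    then show ?thesis by (simp add: vec_eq_iff)
  qed
  also have "\<dots> \<in> ?L"
  proof (rule cmat.span_sum, rule cmat.span_scale, rule sum_permutations_tensor_op_mem_span[OF adj])
    show "(E \<circ> k) i \<in> mat_commutant H" for k and i :: 'n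
      using T(2) by (auto simp: E_def case_prod_beta')
  qed
  finally have "cscale (1 / fact CARD('n)) (cscale (fact CARD('n)) X) \<in> ?L"
    by (rule cmat.span_scale)
  then show ?thesis by simp
qed


section \<open>Compression to the (anti)symmetric subspace\<close>

text \<open>Treats both signs at once: \<epsilon> is constantly 1 for the symmetric subspace and the
  sign of the permutation for the antisymmetric one.\<close>

locale permutation_eigenspace =
  fixes W :: "(complex^('n::finite \<Rightarrow> 'd::finite)) set" and \<epsilon> :: "('n \<Rightarrow> 'n) \<Rightarrow> complex"
    and P :: "complex^('n \<Rightarrow> 'd)^('n \<Rightarrow> 'd)"
  defines "P \<equiv> orth_projector W"
  assumes projector: "is_orth_projector P W"
    and permute: "\<And>p \<psi>. p permutes UNIV \<Longrightarrow> \<psi> \<in> W \<Longrightarrow> permute_factors p \<psi> = \<epsilon> p *s \<psi>"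
    and invariant: "\<And>V \<psi>. \<psi> \<in> W \<Longrightarrow> tensor_power V *v \<psi> \<in> W"
    and unimodular: "\<And>p. p permutes UNIV \<Longrightarrow> \<epsilon> p * cnj (\<epsilon> p) = 1"
begin

lemma P_adj: "conj_transpose P = P" and P_idem: "P ** P = P" and P_mem: "P *v \<psi> \<in> W"
  using projector by (auto simp: is_orth_projector_def)

lemma perm_matrix_P: "p permutes UNIV \<Longrightarrow> perm_matrix p ** P = cscale (\<epsilon> p) P"
proof -
  assume p: "p permutes UNIV"
  have scale: "cscale c A *v \<psi> = c *s (A *v \<psi>)" for c :: complex and A :: "complex^('n \<Rightarrow> 'd)^('n \<Rightarrow> 'd)" and \<psi>
    by (simp add: vec_eq_iff matrix_vector_mult_def sum_distrib_left mult.assoc)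
  show ?thesis
    by (simp add: matrix_eq scale perm_matrix_vector_mult permute[OF p P_mem] flip: matrix_vector_mul_assoc)
qed

lemma P_perm_matrix: "p permutes UNIV \<Longrightarrow> P ** perm_matrix (inv_into UNIV p) = cscale (cnj (\<epsilon> p)) P"
proof -
  assume p: "p permutes UNIV"
  have "conj_transpose (cscale (\<epsilon> p) P) = cscale (cnj (\<epsilon> p)) (conj_transpose P)"
    by (simp add: vec_eq_iff)
  then show ?thesis
    using arg_cong[OF perm_matrix_P[OF p], of conj_transpose]
    by (simp add: conj_transpose_mul conj_transpose_perm_matrix[OF p] P_adj)
qed

text \<open>Invariance of \<open>W\<close> gives \<open>P V P = V P\<close> for every tensor power.
  The adjoint of this identity for the adjoint matrix gives \<open>P V P = P V\<close>.\<close>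

lemma P_tensor_power: "P ** tensor_power V = tensor_power V ** P"
proof -
  have PVP: "P ** tensor_power V ** P = tensor_power V ** P" for V :: "complex^'d^'d"
    using is_orth_projector_fixes[OF projector] invariant[OF P_mem]
    by (simp add: matrix_eq flip: matrix_vector_mul_assoc)
  have "conj_transpose (tensor_power V :: complex^('n \<Rightarrow> 'd)^('n \<Rightarrow> 'd)) = tensor_power (conj_transpose V)"
    by (simp add: vec_eq_iff tensor_power_def)
  then have "conj_transpose (P ** tensor_power V ** P) = P ** tensor_power (conj_transpose V) ** P"
    by (simp add: conj_transpose_mul P_adj matrix_mul_assoc)
  also have "\<dots> = conj_transpose (P ** tensor_power V)"
    using \<open>conj_transpose (tensor_power V) = _\<close> by (simp add: PVP conj_transpose_mul P_adj)
  finally have "P ** tensor_power V ** P = P ** tensor_power V"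
    by (metis conj_transpose_conj_transpose)
  then show ?thesis
    by (simp add: PVP)
qed

text \<open>Relabelling the factors is conjugation by a permutation operator. Inside the compression
  it contributes \<epsilon> times its conjugate, which is 1, so all terms of the sum agree.\<close>

lemma compress_tensor_op:
  "cscale (fact CARD('n)) (P ** tensor_op a ** P) = P ** (\<Sum>p | p permutes UNIV. tensor_op (a \<circ> p)) ** P"
proof -
  have *: "P ** tensor_op (a \<circ> inv_into UNIV p) ** P = P ** tensor_op a ** P" if p: "p permutes UNIV" for p
  proof -
    let ?q = "inv_into UNIV p"
    have pq: "perm_matrix p ** perm_matrix ?q = (mat 1 :: complex^('n \<Rightarrow> 'd)^('n \<Rightarrow> 'd))"
      by (simp add: perm_matrix_mult permutes_inv_o[OF p] perm_matrix_id)
    have q: "?q permutes UNIV" and qq: "inv_into UNIV ?q = p"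
      using p by (simp_all add: permutes_inv permutes_inv_inv)
    have "tensor_op (a \<circ> ?q) = tensor_op (a \<circ> ?q) ** (perm_matrix p ** perm_matrix ?q)"
      by (simp add: pq)
    also have "\<dots> = perm_matrix p ** tensor_op a ** perm_matrix ?q"
      by (simp only: matrix_mul_assoc perm_matrix_tensor_op[OF p, symmetric])
    finally have "P ** tensor_op (a \<circ> ?q) ** P = (P ** perm_matrix p) ** tensor_op a ** (perm_matrix ?q ** P)"
      by (simp only: matrix_mul_assoc)
    also have "\<dots> = cscale (\<epsilon> ?q * cnj (\<epsilon> ?q)) (P ** tensor_op a ** P)"
      using P_perm_matrix[OF q] perm_matrix_P[OF q]
      by (simp add: qq cscale_mult_left cscale_mult_right)
    finally show ?thesis
      by (simp add: unimodular[OF q])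
  qed
  have "P ** (\<Sum>p | p permutes UNIV. tensor_op (a \<circ> p)) ** P = (\<Sum>p | p permutes UNIV. P ** tensor_op (a \<circ> p) ** P)"
    by (simp only: matrix_mult_sum_left matrix_mult_sum_right)
  also have "\<dots> = (\<Sum>p | p permutes UNIV. P ** tensor_op (a \<circ> inv_into UNIV p) ** P)"
    by (rule sum_permutations_inverse)
  also have "\<dots> = (\<Sum>p | p permutes (UNIV :: 'n set). P ** tensor_op a ** P)"
    by (intro sum.cong refl) (simp add: *)
  also have "\<dots> = cscale (fact CARD('n)) (P ** tensor_op a ** P)"
    by (simp only: vec_eq_iff sum_component) (simp add: card_permutations)
  finally show ?thesis by simp
qed

lemma compress_span:
  assumes "X \<in> cmat.span (tensor_power ` H)"
  shows "P ** X ** P \<in> Alg (compressed_tensor_powers W H)"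
  using assms
proof (induction rule: cmat.span_induct_alt)
  case base
  then show ?case by (simp add: Alg_def cmat.span_zero)
next
  case (step c x y)
  then have "P ** x ** P \<in> compressed_tensor_powers W H"
    by (auto simp: compressed_tensor_powers_def P_def)
  with step show ?case
    by (simp add: Alg_def matrix_add_ldistrib matrix_add_rdistrib cscale_mult_left cscale_mult_right
        cmat.span_add cmat.span_scale cmat.span_base)
qed

text \<open>The inclusion from left to right applies the double commutant theorem on the full tensor
  power and then compresses; the converse holds because commuting matrices have commuting compressed
  tensor powers.\<close>

lemma commutant_compressed_tensor_powers:
  assumes H: "subgroup H unitary_group" and centralizer: "unitary_centralizer H = G"
    and H': "unitary_centralizer G = H"
  shows "commutant_on W (Alg (compressed_tensor_powers W G)) = Alg (compressed_tensor_powers W H)"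
proof
  have HU: "H \<subseteq> carrier unitary_group"
    using H by (rule subgroup.subset)
  have one: "mat 1 \<in> H"
    using subgroup.one_closed[OF H] by (simp add: unitary_group_def)
  have mult: "A ** B \<in> H" if "A \<in> H" "B \<in> H" for A B
    using subgroup.m_closed[OF H that] by (simp add: unitary_group_def)
  \<comment> \<open>Inverses in the unitary group are adjoints, so a subgroup is closed under
    adjoints.\<close>
  have adj: "conj_transpose A \<in> H" if "A \<in> H" for A
  proof -
    have "inv\<^bsub>unitary_group\<^esub> A = conj_transpose A"
      using that HU by (intro group.inv_equality[OF group_unitary_group]) (auto simp: unitary_group_def)
    then show ?thesis
      using subgroup.m_inv_closed[OF H that] by simp
  qed
  have HG: "A \<in> mat_commutant G" if "A \<in> H" for A
    using that H' by (auto simp: unitary_centralizer_def mat_commutant_def)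
  \<comment> \<open>As the centralizer of the adjoint-closed \<open>H\<close>, the set
    \<open>G\<close> is adjoint-closed too.\<close>
  have adjG: "conj_transpose A \<in> G" if "A \<in> G" for A
  proof -
    have "A \<in> mat_commutant H" "A \<in> carrier unitary_group"
      using that centralizer by (auto simp: unitary_centralizer_def mat_commutant_def)
    then show ?thesis
      using mat_commutant_conj_transpose[of H A] adj centralizer
      by (auto simp: unitary_centralizer_def mat_commutant_def unitary_group_def)
  qed
  show "commutant_on W (Alg (compressed_tensor_powers W G)) \<subseteq> Alg (compressed_tensor_powers W H)"
  proof
    fix X assume X: "X \<in> commutant_on W (Alg (compressed_tensor_powers W G))"
    then have PXP: "P ** X ** P = X"
      by (simp add: commutant_on_def End_on_def P_def)
    then have PX: "P ** X = X" and XP: "X ** P = X"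
      by (metis P_idem matrix_mul_assoc)+
    have comm: "X ** tensor_power V = tensor_power V ** X" if "V \<in> G" for V
    proof -
      have "P ** tensor_power V ** P \<in> Alg (compressed_tensor_powers W G)"
        using that by (auto simp: Alg_def compressed_tensor_powers_def P_def intro!: cmat.span_base)
      then have "X ** (P ** tensor_power V ** P) = (P ** tensor_power V ** P) ** X"
        using X by (simp add: commutant_on_def)
      moreover have "X ** (P ** tensor_power V ** P) = X ** P ** P ** tensor_power V"
        by (simp only: matrix_mul_assoc P_tensor_power[symmetric])
          (simp only: P_tensor_power[symmetric] flip: matrix_mul_assoc)
      moreover have "(P ** tensor_power V ** P) ** X = tensor_power V ** (P ** (P ** X))"
        by (simp only: matrix_mul_assoc P_tensor_power)
      ultimately show ?thesis
        by (simp add: PX XP)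
    qed
    have "X \<in> mat_commutant (mat_commutant (local_perm_ops H))"
      unfolding mat_commutant_def[of "mat_commutant _"]
    proof (intro CollectI ballI)
      fix Y :: "complex^('n \<Rightarrow> 'd)^('n \<Rightarrow> 'd)" assume "Y \<in> mat_commutant (local_perm_ops H)"
      then have "Y \<in> cmat.span (tensor_power ` G)"
        using mat_commutant_local_perm_ops[OF one adj] centralizer by blast
      then show "X ** Y = Y ** X"
        by (induction rule: cmat.span_induct_alt)
          (auto simp: comm matrix_add_ldistrib matrix_add_rdistrib cscale_mult_left cscale_mult_right)
    qed
    then have "X \<in> cmat.span (local_perm_ops H)"
      by (intro double_commutant local_perm_ops_mult local_perm_ops_conj_transpose)
        (auto intro: mult adj perm_matrix_mem_local_perm_ops[OF one permutes_id, unfolded perm_matrix_id])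
    then have "P ** X ** P \<in> Alg (compressed_tensor_powers W H)"
    proof (induction rule: cmat.span_induct_alt)
      case base
      then show ?case by (simp add: Alg_def cmat.span_zero)
    next
      case (step c x y)
      obtain a p where x: "x = tensor_op a ** perm_matrix p" "range a \<subseteq> H" "p permutes UNIV"
        using step(1) unfolding local_perm_ops_def by blast
      \<comment> \<open>The projector absorbs the permutation as a scalar; the factorial and its
        inverse are inserted to make \<open>compress_tensor_op\<close> applicable.\<close>
      have "P ** x ** P = P ** tensor_op a ** (perm_matrix p ** P)"
        by (simp only: x matrix_mul_assoc)
      also have "\<dots> = cscale (\<epsilon> p / fact CARD('n)) (cscale (fact CARD('n)) (P ** tensor_op a ** P))"
        by (simp add: perm_matrix_P[OF x(3)] cscale_mult_right)
      also have "\<dots> \<in> Alg (compressed_tensor_powers W H)"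
        unfolding compress_tensor_op
      proof -
        \<comment> \<open>Polarization for the commutant of \<open>G\<close>: it contains
          \<open>H\<close>, and its unitary elements are again those of \<open>H\<close>.\<close>
        have "(\<Sum>p | p permutes UNIV. tensor_op (a \<circ> p)) \<in> cmat.span (tensor_power ` unitary_centralizer G)"
          using x(2) HG by (intro sum_permutations_tensor_op_mem_span adjG) auto
        then show "cscale (\<epsilon> p / fact CARD('n)) (P ** (\<Sum>p | p permutes UNIV. tensor_op (a \<circ> p)) ** P)
            \<in> Alg (compressed_tensor_powers W H)"
          using compress_span by (simp add: H' Alg_def cmat.span_scale)
      qed
      finally show ?case
        using step by (simp add: Alg_def matrix_add_ldistrib matrix_add_rdistrib cscale_mult_left cscale_mult_right
            cmat.span_add cmat.span_scale)
    qed
    then show "X \<in> Alg (compressed_tensor_powers W H)"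
      by (simp add: PXP)
  qed
  show "Alg (compressed_tensor_powers W H) \<subseteq> commutant_on W (Alg (compressed_tensor_powers W G))"
  proof
    fix X assume X: "X \<in> Alg (compressed_tensor_powers W H)"
    have comm: "(P ** tensor_power U ** P) ** (P ** tensor_power V ** P) = P ** tensor_power (U ** V) ** P" for U V
    proof -
      have "(P ** tensor_power U ** P) ** (P ** tensor_power V ** P) =
          P ** tensor_power U ** (P ** P) ** tensor_power V ** P"
        by (simp only: matrix_mul_assoc)
      also have "\<dots> = P ** tensor_power U ** (P ** tensor_power V) ** P"
        by (simp only: P_idem matrix_mul_assoc)
      also have "\<dots> = P ** (tensor_power U ** tensor_power V) ** (P ** P)"
        by (simp only: P_tensor_power matrix_mul_assoc)
      finally show ?thesis
        by (simp only: P_idem tensor_power_mul)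
    qed
    show "X \<in> commutant_on W (Alg (compressed_tensor_powers W G))"
      unfolding commutant_on_def
    proof (intro CollectI conjI ballI)
      have "P ** X ** P = X"
        using X unfolding Alg_def
      proof (induction rule: cmat.span_induct_alt)
        case (step c x y)
        then obtain V where "x = P ** tensor_power V ** P"
          by (auto simp: compressed_tensor_powers_def P_def)
        then have "P ** x ** P = (P ** P) ** tensor_power V ** (P ** P)"
          by (simp only: matrix_mul_assoc)
        then have "P ** x ** P = x"
          by (simp add: P_idem \<open>x = _\<close>)
        with step show ?case
          by (simp add: matrix_add_ldistrib matrix_add_rdistrib cscale_mult_left cscale_mult_right)
      qed simp
      then show "X \<in> End_on W"
        by (simp add: End_on_def P_def)
      fix Y assume Y: "Y \<in> Alg (compressed_tensor_powers W G)"
      \<comment> \<open>Linearity is used first in \<open>X\<close>, against a single generator, and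
        afterwards in \<open>Y\<close>.\<close>
      have XV: "X ** (P ** tensor_power V ** P) = (P ** tensor_power V ** P) ** X" if V: "V \<in> G" for V
        using X unfolding Alg_def
      proof (induction rule: cmat.span_induct_alt)
        case (step c x y)
        then obtain U where U: "x = P ** tensor_power U ** P" "U \<in> H"
          by (auto simp: compressed_tensor_powers_def P_def)
        then have "U ** V = V ** U"
          using V HG by (auto simp: mat_commutant_def)
        with step U show ?case
          by (simp add: comm matrix_add_ldistrib matrix_add_rdistrib cscale_mult_left cscale_mult_right)
      qed simp
      show "X ** Y = Y ** X"
        using Y unfolding Alg_def
      proof (induction rule: cmat.span_induct_alt)
        case (step c x y)
        then have "X ** x = x ** X"
          using XV by (auto simp: compressed_tensor_powers_def P_def)
        with step show ?case
          by (simp add: matrix_add_ldistrib matrix_add_rdistrib cscale_mult_left cscale_mult_right)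
      qed simp
    qed
  qed
qed

end

section \<open>The symmetric and the antisymmetric case\<close>

lemma permutation_eigenspace_symmetric:
  "permutation_eigenspace (symmetric_subspace :: (complex^('n::finite \<Rightarrow> 'd::finite)) set) (\<lambda>_. 1)"
proof
  show "is_orth_projector (orth_projector symmetric_subspace)
      (symmetric_subspace :: (complex^('n \<Rightarrow> 'd)) set)"
    by (rule is_orth_projector_symmetric)
qed (auto simp: symmetric_subspace_def permute_factors_tensor_power)

lemma permutation_eigenspace_antisymmetric:
  "permutation_eigenspace (antisymmetric_subspace :: (complex^('n::finite \<Rightarrow> 'd::finite)) set) (\<lambda>p. of_int (sign p))"
proof
  show "is_orth_projector (orth_projector antisymmetric_subspace)
      (antisymmetric_subspace :: (complex^('n \<Rightarrow> 'd)) set)"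
    by (rule is_orth_projector_antisymmetric)
  show "of_int (sign p) * cnj (of_int (sign p)) = 1" for p :: "'n \<Rightarrow> 'n"
    by (simp add: sign_def)
qed (auto simp: antisymmetric_subspace_def permute_factors_tensor_power vec.scale)

theorem theorem7:
  fixes G G' :: "(complex^'d::finite^'d) set"
    and W :: "(complex^('n::finite \<Rightarrow> 'd)) set"
  assumes "subgroup G unitary_group" and "subgroup G' unitary_group"
    and "unitary_centralizer G = G'" and "unitary_centralizer G' = G"
    and "W \<in> {symmetric_subspace, antisymmetric_subspace}"
  shows "commutant_on W (Alg (compressed_tensor_powers W G)) = Alg (compressed_tensor_powers W G')
    \<and> commutant_on W (Alg (compressed_tensor_powers W G')) = Alg (compressed_tensor_powers W G)"
proof -
  obtain \<epsilon> where "permutation_eigenspace W \<epsilon>"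
    using assms(5) permutation_eigenspace_symmetric permutation_eigenspace_antisymmetric by blast
  \<comment> \<open>Both equalities are instances of the same locale result, with the roles of
    \<open>G\<close> and \<open>G'\<close> exchanged.\<close>
  then show ?thesis
    using permutation_eigenspace.commutant_compressed_tensor_powers assms(1-4) by metis
qed

end
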